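(* Work in the setting of the context (in particular $R(\cdot)+\bar R(\cdot+\delta)\equiv0$). Let $M\ge0$ be a symmetric $n\times n$ matrix, suppose that $B(\cdot)=I$ and that, for every $i=0,1,2,\dots$, with $\hat A_i$ given by the iterative scheme of the context, the solution $\Upsilon_i(\cdot)$ of the time-advanced ODE $$\dot\Upsilon_i(t)=\hat A_i(t)^\top\Upsilon_i(t)+\bar B(t+\delta)^\top\Upsilon_i(t+\delta),\ t\in[s,T],\qquad\Upsilon_i(s)=I,\quad\Upsilon_i(t)=0,\ t\in(T,T+\delta],$$ satisfies $\Upsilon_i(\cdot)>0$ on $[s,T]$ (positive definite). Then the delayed Riccati equation $$\left\{\begin{aligned}\dot\Sigma(t)=&-\Sigma A^\top-A\Sigma+2\Sigma[Q(t)+\bar Q(t+\delta)]\Sigma-B\Sigma B^\top-C\mathcal N^{-1}C^\top\\ &-\bar B(t)\Sigma(t-\delta)\bar B(t)^\top-\bar C(t)\mathcal N^{-1}(t-\delta)\bar C(t)^\top,\quad t\in[s,T],\\ \Sigma(T)=&\ M,\qquad\Sigma(t)=I,\ t\in[s-\delta,s),\end{aligned}\right.$$ has a unique solution $\Sigma(\cdot)\in C([s,T];\mathbf S^n_+)$. Furthermore, suppose that, with $\hat A(t):=A(t)-2\Sigma(t)[Q(t)+\bar Q(t+\delta)]$ for this solution $\Sigma$, the solution $\Upsilon(\cdot)$ of the time-advanced ODE $$\dot\Upsilon(t)=\hat A(t)^\top\Upsilon(t)+\bar B(t+\delta)^\top\Upsilon(t+\delta),\ t\in[s,T],\qquad\Upsilon(s)=I,\quad\Upsilon(t)=0,\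 t\in(T,T+\delta],$$ satisfies $\Upsilon(\cdot)>0$ on $[s,T]$; then (i) when $M>0$, $\Sigma(\cdot)\in C([s,T];\bar{\mathbf S}^n_+)$; (ii) when $M\ge0$, $\Sigma(\cdot)\in C([s,T];\mathbf S^n_+)$.
   Context: $T>0$, $s\in[0,T]$, and $\delta>0$ is a sufficiently small delay (there is $\delta_0>0$ depending only on $T$ and on bounds of the data such that $0<\delta\le\delta_0$ is assumed). $\mathbf S^n$: symmetric $n\times n$ real matrices; $\mathbf S^n_+$: positive semidefinite ones; $\bar{\mathbf S}^n_+$: positive definite ones. All coefficients are deterministic bounded measurable functions, defined at all times at which they are evaluated: $A,B,\bar B$ are $\mathbf R^{n\times n}$-valued, $C,\bar C$ are $\mathbf R^{n\times d}$-valued, $Q,\bar Q,R,\bar R$ are $\mathbf S^n$-valued, $N,\bar N$ are $\mathbf S^d$-valued; for some $\alpha>0$, $Q(t)+\bar Q(t+\delta)\ge0$ and $N(t)+\bar N(t+\delta)\ge\alpha I$ for a.e. $t\in[s-\delta,T]$; and $R(t)+\bar R(t+\delta)\equiv0$. $\mathcal N(t):=2N(t)+2\bar N(t+\delta)$. The prescribed values $\Sigma=I$ on $[s-\delta,s)$ are not required to match $\Sigma(s)$. Iterative scheme: $\Sigma^0(t)=M$ for $t\in[s,T]$, $\Sigma^0(t)=I$ for $t\in[s-\delta,s)$; for $i=0,1,2,\dots$, $$\hat A_i(t)=A(t)-2\Sigma^i(t)[Q(t)+\bar Q(t+\delta)],$$ $$\hat H_i(t)=C(t)\mathcal N^{-1}(t)C(t)^\top+\bar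 C(t)\mathcal N^{-1}(t-\delta)\bar C(t)^\top+2\Sigma^i(t)[Q(t)+\bar Q(t+\delta)]\Sigma^i(t),$$ and $\Sigma^{i+1}$ is the solution of $$\dot\Sigma^{i+1}=-\Sigma^{i+1}\hat A_i^\top-\hat A_i\Sigma^{i+1}-B\Sigma^{i+1}B^\top-\bar B(t)\Sigma^{i+1}(t-\delta)\bar B(t)^\top-\hat H_i,\ t\in[s,T],\quad\Sigma^{i+1}(T)=M,\ \Sigma^{i+1}(t)=I\text{ on }[s-\delta,s).$$ *)

theory Defs
  imports "HOL-Analysis.Analysis"
begin

definition psd :: "real^'n^'n \<Rightarrow> bool" where
  "psd X \<longleftrightarrow> transpose X = X \<and> (\<forall>x. 0 \<le> x \<bullet> (X *v x))"

definition spd :: "real^'n^'n \<Rightarrow> bool" where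
  "spd X \<longleftrightarrow> transpose X = X \<and> (\<forall>x. x \<noteq> 0 \<longrightarrow> 0 < x \<bullet> (X *v x))"

(* Symmetry is deliberately not required: this is the sense of Y > 0 for solutions Y of the
   time-advanced equation, which are not symmetric in general.  It is implied by spd. *)
definition pos_def :: "real^'n^'n \<Rightarrow> bool" where
  "pos_def X \<longleftrightarrow> (\<forall>x. x \<noteq> 0 \<longrightarrow> 0 < x \<bullet> (X *v x))"

definition bounded_measurable :: "real \<Rightarrow> real set \<Rightarrow> (real \<Rightarrow> 'a::euclidean_space) \<Rightarrow> bool" where
  "bounded_measurable K I f \<longleftrightarrow>
     f \<in> borel_measurable (lebesgue_on I) \<and> (\<forall>t\<in>I. norm (f t) \<le> K)"

(* X is absolutely continuous on [s,T] with derivative F almost everywhere (Caratheodory sense;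
   the coefficients are only measurable). *)
definition ode_solution :: "real \<Rightarrow> real \<Rightarrow> (real \<Rightarrow> 'a::euclidean_space) \<Rightarrow> (real \<Rightarrow> 'a) \<Rightarrow> bool" where
  "ode_solution s T X F \<longleftrightarrow>
     F absolutely_integrable_on {s..T} \<and> (\<forall>t\<in>{s..T}. X t = X s + integral {s..t} F)"

record ('n, 'd) lq_coeffs =
  cA :: "real \<Rightarrow> real^'n^'n"
  cB :: "real \<Rightarrow> real^'n^'n"
  cBbar :: "real \<Rightarrow> real^'n^'n"
  cC :: "real \<Rightarrow> real^'d^'n"
  cCbar :: "real \<Rightarrow> real^'d^'n"
  cQ :: "real \<Rightarrow> real^'n^'n"
  cQbar :: "real \<Rightarrow> real^'n^'n"
  cR :: "real \<Rightarrow> real^'n^'n"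
  cRbar :: "real \<Rightarrow> real^'n^'n"
  cN :: "real \<Rightarrow> real^'d^'d"
  cNbar :: "real \<Rightarrow> real^'d^'d"

(* Every coefficient is constrained exactly on the interval where it is evaluated;
   its values elsewhere are irrelevant. *)
definition admissible ::
  "real \<Rightarrow> real \<Rightarrow> real \<Rightarrow> real \<Rightarrow> real \<Rightarrow> ('n::finite, 'd::finite) lq_coeffs \<Rightarrow> bool" where
  "admissible K \<alpha> s T \<delta> p \<longleftrightarrow>
     bounded_measurable K {s..T} (cA p) \<and>
     bounded_measurable K {s..T} (cB p) \<and>
     bounded_measurable K {s..T+\<delta>} (cBbar p) \<and>
     bounded_measurable K {s..T} (cC p) \<and>
     bounded_measurable K {s..T} (cCbar p) \<and>
     bounded_measurable K {s-\<delta>..T} (cQ p) \<and>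
     bounded_measurable K {s..T+\<delta>} (cQbar p) \<and>
     bounded_measurable K {s-\<delta>..T} (cR p) \<and>
     bounded_measurable K {s..T+\<delta>} (cRbar p) \<and>
     bounded_measurable K {s-\<delta>..T} (cN p) \<and>
     bounded_measurable K {s..T+\<delta>} (cNbar p) \<and>
     (\<forall>t\<in>{s-\<delta>..T}. transpose (cQ p t) = cQ p t \<and> transpose (cR p t) = cR p t \<and>
                  transpose (cN p t) = cN p t) \<and>
     (\<forall>t\<in>{s..T+\<delta>}. transpose (cQbar p t) = cQbar p t \<and> transpose (cRbar p t) = cRbar p t \<and>
                  transpose (cNbar p t) = cNbar p t) \<and>
     (AE t in lebesgue. t \<in> {s-\<delta>..T} \<longrightarrow> psd (cQ p t + cQbar p (t+\<delta>))) \<and>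
     (AE t in lebesgue. t \<in> {s-\<delta>..T} \<longrightarrow> psd (cN p t + cNbar p (t+\<delta>) - \<alpha> *\<^sub>R mat 1)) \<and>
     (\<forall>t\<in>{s-\<delta>..T}. cR p t + cRbar p (t+\<delta>) = 0)"

definition calN :: "('n::finite, 'd::finite) lq_coeffs \<Rightarrow> real \<Rightarrow> real \<Rightarrow> real^'d^'d" where
  "calN p \<delta> t = 2 *\<^sub>R cN p t + 2 *\<^sub>R cNbar p (t+\<delta>)"

definition riccati_rhs ::
  "('n::finite, 'd::finite) lq_coeffs \<Rightarrow> real \<Rightarrow> (real \<Rightarrow> real^'n^'n) \<Rightarrow> real \<Rightarrow> real^'n^'n" where
  "riccati_rhs p \<delta> X t =
     - (X t ** transpose (cA p t)) - cA p t ** X t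
     + 2 *\<^sub>R (X t ** (cQ p t + cQbar p (t+\<delta>)) ** X t)
     - cB p t ** X t ** transpose (cB p t)
     - cC p t ** matrix_inv (calN p \<delta> t) ** transpose (cC p t)
     - cBbar p t ** X (t-\<delta>) ** transpose (cBbar p t)
     - cCbar p t ** matrix_inv (calN p \<delta> (t-\<delta>)) ** transpose (cCbar p t)"

definition riccati_solution ::
  "('n::finite, 'd::finite) lq_coeffs \<Rightarrow> real \<Rightarrow> real \<Rightarrow> real \<Rightarrow> real^'n^'n
    \<Rightarrow> (real \<Rightarrow> real^'n^'n) \<Rightarrow> bool" where
  "riccati_solution p \<delta> s T M X \<longleftrightarrow>
     ode_solution s T X (riccati_rhs p \<delta> X) \<and> X T = M \<and> (\<forall>t\<in>{s-\<delta>..<s}. X t = mat 1)"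

definition Ahat ::
  "('n::finite, 'd::finite) lq_coeffs \<Rightarrow> real \<Rightarrow> (real \<Rightarrow> real^'n^'n) \<Rightarrow> real \<Rightarrow> real^'n^'n" where
  "Ahat p \<delta> X t = cA p t - 2 *\<^sub>R (X t ** (cQ p t + cQbar p (t+\<delta>)))"

definition Hhat ::
  "('n::finite, 'd::finite) lq_coeffs \<Rightarrow> real \<Rightarrow> (real \<Rightarrow> real^'n^'n) \<Rightarrow> real \<Rightarrow> real^'n^'n" where
  "Hhat p \<delta> X t =
     cC p t ** matrix_inv (calN p \<delta> t) ** transpose (cC p t)
     + cCbar p t ** matrix_inv (calN p \<delta> (t-\<delta>)) ** transpose (cCbar p t)
     + 2 *\<^sub>R (X t ** (cQ p t + cQbar p (t+\<delta>)) ** X t)"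

definition scheme_rhs ::
  "('n::finite, 'd::finite) lq_coeffs \<Rightarrow> real \<Rightarrow> (real \<Rightarrow> real^'n^'n) \<Rightarrow> (real \<Rightarrow> real^'n^'n)
    \<Rightarrow> real \<Rightarrow> real^'n^'n" where
  "scheme_rhs p \<delta> X Y t =
     - (Y t ** transpose (Ahat p \<delta> X t)) - Ahat p \<delta> X t ** Y t
     - cB p t ** Y t ** transpose (cB p t)
     - cBbar p t ** Y (t-\<delta>) ** transpose (cBbar p t)
     - Hhat p \<delta> X t"

definition iterative_scheme ::
  "('n::finite, 'd::finite) lq_coeffs \<Rightarrow> real \<Rightarrow> real \<Rightarrow> real \<Rightarrow> real^'n^'n
    \<Rightarrow> (nat \<Rightarrow> real \<Rightarrow> real^'n^'n) \<Rightarrow> bool" where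
  "iterative_scheme p \<delta> s T M X \<longleftrightarrow>
     (\<forall>t\<in>{s..T}. X 0 t = M) \<and> (\<forall>t\<in>{s-\<delta>..<s}. X 0 t = mat 1) \<and>
     (\<forall>i. ode_solution s T (X (Suc i)) (scheme_rhs p \<delta> (X i) (X (Suc i))) \<and>
          X (Suc i) T = M \<and> (\<forall>t\<in>{s-\<delta>..<s}. X (Suc i) t = mat 1))"

definition advanced_solution ::
  "('n::finite, 'd::finite) lq_coeffs \<Rightarrow> real \<Rightarrow> real \<Rightarrow> real \<Rightarrow> (real \<Rightarrow> real^'n^'n)
    \<Rightarrow> (real \<Rightarrow> real^'n^'n) \<Rightarrow> bool" where
  "advanced_solution p \<delta> s T F Y \<longleftrightarrow>
     ode_solution s T Y
       (\<lambda>t. transpose (F t) ** Y t + transpose (cBbar p (t+\<delta>)) ** Y (t+\<delta>)) \<and>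
     Y s = mat 1 \<and> (\<forall>t\<in>{T<..T+\<delta>}. Y t = 0)"

end

theory Submission
  imports Defs
begin

text \<open>
  For small \<open>\<delta>\<close> the delayed linear equation preserves positivity. Let \<open>D\<close> solve such an equation with a nonnegative
  source, and let \<open>-\<eta>\<close> be the minimum of \<open>exp (-\<mu> (T - t)) * (x \<bullet> D t x)\<close> over all times \<open>t\<close> and unit
  vectors \<open>x\<close>. If \<open>\<eta> > 0\<close>, then \<open>D t + \<eta> exp (\<mu> (T - t)) I\<close> is positive semidefinite with \<open>x\<close> in its
  kernel at the minimal time, the delayed value loses at most the factor \<open>exp (\<mu> \<delta>) \<le> 3\<close>, and for
  large \<open>\<mu>\<close> the equation contradicts minimality immediately after that time.

  The Riccati equation is solved by a contraction in a weighted norm after cutting the quadratic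
  term off at a radius \<open>\<rho>\<close>. The cut-off equation is again linear with bounded coefficients along its
  solution, so the solution is positive semidefinite; comparison with a multiple of
  \<open>exp (\<nu> (T - t)) I\<close> shows that it stays below \<open>\<rho>\<close>, so that the cut-off is inactive. The same
  comparison bounds every positive semidefinite solution, which gives uniqueness, and comparison from
  below with \<open>\<epsilon> exp (-2 c (T - t)) I\<close> gives strict positivity.
\<close>

section \<open>Real matrices and quadratic forms\<close>

text \<open>The norm of the matrix type is the Frobenius norm, the L2 norm of the norms of the rows;
  Cauchy-Schwarz in each row gives the estimate.\<close>

lemma norm_matrix_vector_mult_le: "norm (A *v x) \<le> norm A * norm (x::real^'n)" for A :: "real^'n^'m"
proof -
  have "norm (A *v x) \<le> L2_set (\<lambda>i. norm (A $ i) * norm x) UNIV"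
    unfolding norm_vec_def[of "A *v x"]
    by (rule L2_set_mono)
      (auto simp: matrix_vector_mul_component row_def vec_nth_inverse Cauchy_Schwarz_ineq2)
  also have "\<dots> = norm A * norm x"
    by (simp add: L2_set_left_distrib norm_vec_def[of A])
  finally show ?thesis .
qed

lemma norm_transpose [simp]: "norm (transpose A) = norm A" for A :: "real^'n^'m"
proof -
  have "(\<Sum>i\<in>UNIV. \<Sum>j\<in>UNIV. (A $ j $ i)\<^sup>2) = (\<Sum>j\<in>UNIV. \<Sum>i\<in>UNIV. (A $ j $ i)\<^sup>2)"
    by (rule sum.swap)
  then show ?thesis
    by (simp add: norm_vec_def L2_set_def transpose_def sum_nonneg)
qed

lemma norm_matrix_mult_le: "norm (A ** B) \<le> norm A * norm B"
  for A :: "real^'n^'m" and B :: "real^'k^'n"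
proof -
  have "norm ((A ** B) $ i) \<le> norm (A $ i) * norm B" for i
  proof -
    have "(A ** B) $ i = transpose B *v (A $ i)"
      by (simp add: vec_eq_iff matrix_matrix_mult_def vector_matrix_mult_def mult.commute)
    then show ?thesis
      using norm_matrix_vector_mult_le[of "transpose B" "A $ i"] by (simp add: mult.commute)
  qed
  then have "norm (A ** B) \<le> L2_set (\<lambda>i. norm (A $ i) * norm B) UNIV"
    unfolding norm_vec_def[of "A ** B"] by (intro L2_set_mono) auto
  also have "\<dots> = norm A * norm B"
    by (simp add: L2_set_left_distrib norm_vec_def[of A])
  finally show ?thesis .
qed

lemma matrix_scaleR_mult:
  fixes A :: "real^'n^'m" and B :: "real^'k^'n"
  shows "(c *\<^sub>R A) ** B = c *\<^sub>R (A ** B)" "A ** (c *\<^sub>R B) = c *\<^sub>R (A ** B)"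
  by (simp_all add: matrix_scalar_ac scalar_matrix_assoc)

lemma bounded_bilinear_matrix_mult:
  "bounded_bilinear ((**) :: real^'n^'m \<Rightarrow> real^'k^'n \<Rightarrow> real^'k^'m)"
proof
  fix A A' :: "real^'n^'m" and B B' :: "real^'k^'n" and r :: real
  show "(A + A') ** B = A ** B + A' ** B" "A ** (B + B') = A ** B + A ** B'"
    by (simp_all add: vec_eq_iff matrix_matrix_mult_def distrib_left distrib_right sum.distrib)
  show "(r *\<^sub>R A) ** B = r *\<^sub>R (A ** B)" "A ** (r *\<^sub>R B) = r *\<^sub>R (A ** B)"
    by (simp_all add: matrix_scaleR_mult)
  show "\<exists>K. \<forall>A B. norm ((A :: real^'n^'m) ** (B :: real^'k^'n)) \<le> norm A * norm B * K"
    by (intro exI[of _ 1]) (simp add: norm_matrix_mult_le)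
qed

lemma bounded_linear_transpose: "bounded_linear (transpose :: real^'n^'m \<Rightarrow> real^'m^'n)"
  by (rule bounded_linear_intro[where K=1], simp_all add: transpose_scalar)
    (simp add: vec_eq_iff transpose_def)

lemma bounded_linear_quadratic_form: "bounded_linear (\<lambda>A :: real^'n^'n. x \<bullet> (A *v x))"
proof (rule bounded_linear_intro[where K="norm x * norm x"])
  fix A B :: "real^'n^'n" and r :: real
  show "x \<bullet> ((A + B) *v x) = x \<bullet> (A *v x) + x \<bullet> (B *v x)"
    by (simp add: matrix_vector_mult_add_rdistrib inner_right_distrib)
  show "x \<bullet> ((r *\<^sub>R A) *v x) = r *\<^sub>R (x \<bullet> (A *v x))"
    by (simp flip: scaleR_matrix_vector_assoc)
  have "\<bar>x \<bullet> (A *v x)\<bar> \<le> norm x * norm (A *v x)"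
    by (rule Cauchy_Schwarz_ineq2)
  also have "\<dots> \<le> norm x * (norm A * norm x)"
    by (intro mult_left_mono norm_matrix_vector_mult_le) simp
  finally show "norm (x \<bullet> (A *v x)) \<le> norm A * (norm x * norm x)"
    by (simp add: mult_ac)
qed

lemma norm_matrix_le_entries:
  fixes A :: "real^'n^'m" and c :: real
  assumes "\<And>i j. \<bar>A $ i $ j\<bar> \<le> c"
  shows "norm A \<le> CARD('m) * CARD('n) * c"
proof -
  have "norm A \<le> (\<Sum>i\<in>UNIV. norm (A $ i))"
    unfolding norm_vec_def[of A] by (rule L2_set_le_sum) simp
  also have "\<dots> \<le> (\<Sum>i\<in>(UNIV::'m set). \<Sum>j\<in>(UNIV::'n set). c)"
    using assms by (intro sum_mono order_trans[OF norm_le_l1_cart]) auto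
  finally show ?thesis by simp
qed

lemma inner_transpose_mult: "x \<bullet> (transpose A *v y) = (A *v x) \<bullet> (y::real^'m)" for A :: "real^'n^'m"
  by (metis dot_lmul_matrix inner_commute transpose_matrix_vector)

lemma quadratic_form_congruence:
  "x \<bullet> ((A ** X ** transpose A) *v x) = (transpose A *v x) \<bullet> (X *v (transpose A *v x))"
  for A :: "real^'n^'m" and X :: "real^'n^'n"
  by (metis dot_lmul_matrix matrix_vector_mul_assoc transpose_matrix_vector)

text \<open>Polarisation: nonnegativity at the sum and the difference of two coordinate vectors
  bounds an off-diagonal entry by the mean of two diagonal ones, and the upper bound on the form
  controls the diagonal. This turns bounds on forms into bounds on norms.\<close>

lemma psd_entry_le:
  fixes X :: "real^'n^'n"
  assumes X: "psd X" and le: "\<And>x. x \<bullet> (X *v x) \<le> c * (x \<bullet> x)"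
  shows "\<bar>X $ i $ j\<bar> \<le> c"
proof -
  let ?e = "\<lambda>i. axis i (1::real) :: real^'n"
  have sym: "X $ j $ i = X $ i $ j" for i j
    using X unfolding psd_def by (metis transpose_def vec_lambda_beta)
  have form: "?e i \<bullet> (X *v ?e j) = X $ i $ j" for i j
    by (simp add: inner_axis' matrix_vector_mul_component inner_axis)
  have diag: "X $ i $ i \<le> c" for i
    using le[of "?e i"] by (simp add: form inner_axis_axis)
  have "0 \<le> (?e i + ?e j) \<bullet> (X *v (?e i + ?e j))" "0 \<le> (?e i - ?e j) \<bullet> (X *v (?e i - ?e j))"
    using X by (auto simp: psd_def)
  then have "2 * \<bar>X $ i $ j\<bar> \<le> X $ i $ i + X $ j $ j"
    using sym[of i j]
    by (simp add: matrix_vector_right_distrib matrix_vector_mult_diff_distrib inner_left_distrib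
        inner_right_distrib inner_diff_left inner_diff_right form)
  with diag[of i] diag[of j] show ?thesis by simp
qed

lemma psd_norm_le:
  fixes X :: "real^'n^'n" and c :: real
  assumes "psd X" "\<And>x. x \<bullet> (X *v x) \<le> c * (x \<bullet> x)"
  shows "norm X \<le> CARD('n) * CARD('n) * c"
  using psd_entry_le[OF assms] by (rule norm_matrix_le_entries)

text \<open>If \<open>X *v x\<close> were nonzero, a small step from \<open>x\<close> against it
  would make the form negative at first order.\<close>

lemma psd_null:
  fixes X :: "real^'n^'n"
  assumes X: "psd X" and x: "x \<bullet> (X *v x) = 0"
  shows "X *v x = 0"
proof (rule ccontr)
  define y where "y = X *v x"
  assume "X *v x \<noteq> 0"
  then have y: "y \<bullet> y > 0" by (simp add: y_def)
  have sym: "y \<bullet> (X *v x) = x \<bullet> (X *v y)"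
    using X unfolding psd_def by (metis inner_commute inner_transpose_mult)
  \<comment> \<open>The added \<open>1\<close> excludes a zero denominator, and the step is short
    enough that the second-order term is at most half of the first-order gain.\<close>
  define e where "e = (y \<bullet> y) / (1 + y \<bullet> (X *v y))"
  have p: "0 \<le> y \<bullet> (X *v y)" using X by (auto simp: psd_def)
  have "0 \<le> (x - e *\<^sub>R y) \<bullet> (X *v (x - e *\<^sub>R y))"
    using X by (auto simp: psd_def)
  also have "\<dots> = e * (e * (y \<bullet> (X *v y)) - 2 * (y \<bullet> y))"
    using x sym by (simp add: matrix_vector_mult_diff_distrib matrix_vector_mult_scaleR inner_diff_left
        inner_diff_right y_def[symmetric] algebra_simps)
  finally have "0 \<le> e * (e * (y \<bullet> (X *v y)) - 2 * (y \<bullet> y))" .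
  moreover have "e > 0" using y p by (simp add: e_def)
  moreover have "e * (y \<bullet> (X *v y)) \<le> y \<bullet> y"
    using y p by (simp add: e_def field_simps)
  ultimately show False using y by (simp add: zero_le_mult_iff)
qed

lemma transpose_add: "transpose (A + B) = transpose A + transpose B"
  and transpose_diff: "transpose (A - B) = transpose A - transpose B" for A B :: "real^'n^'m"
  by (simp_all add: vec_eq_iff transpose_def)

lemma bounded_bilinear_matrix_vector_mult:
  "bounded_bilinear ((*v) :: real^'n^'m \<Rightarrow> real^'n \<Rightarrow> real^'m)"
proof
  fix A A' :: "real^'n^'m" and x y :: "real^'n" and r :: real
  show "(A + A') *v x = A *v x + A' *v x" "A *v (x + y) = A *v x + A *v y"
    by (simp_all add: matrix_vector_mult_add_rdistrib matrix_vector_right_distrib)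
  show "(r *\<^sub>R A) *v x = r *\<^sub>R (A *v x)" "A *v (r *\<^sub>R x) = r *\<^sub>R (A *v x)"
    by (simp_all add: scaleR_matrix_vector_assoc matrix_vector_mult_scaleR)
  show "\<exists>K. \<forall>A x. norm ((A :: real^'n^'m) *v (x :: real^'n)) \<le> norm A * norm x * K"
    by (intro exI[of _ 1]) (simp add: norm_matrix_vector_mult_le)
qed

lemma matrix_diff_distrib: "(A - B) ** C = A ** C - B ** C" "D ** (A - B) = D ** A - D ** B"
  for A B :: "real^'n^'m" and C :: "real^'k^'n" and D :: "real^'m^'l"
  by (simp_all add: vec_eq_iff matrix_matrix_mult_def left_diff_distrib right_diff_distrib sum_subtractf)

lemma matrix_add_rdistrib: "(A + B) ** C = A ** C + B ** C"
  for A B :: "real^'n^'m" and C :: "real^'k^'n"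
  by (simp add: vec_eq_iff matrix_matrix_mult_def distrib_right sum.distrib)

lemma norm_mult_le:
  fixes A :: "real^'i^'j" and B :: "real^'l^'i"
  assumes "norm A \<le> x" "norm B \<le> y" "0 \<le> x"
  shows "norm (A ** B) \<le> x * y"
  using assms norm_matrix_mult_le[of A B] by (meson mult_mono norm_ge_zero order_trans)

lemma quadratic_form_transpose: "x \<bullet> (transpose A *v x) = x \<bullet> (A *v x)" for A :: "real^'n^'n"
  by (metis inner_commute inner_transpose_mult)

lemma abs_quadratic_form_le: "\<bar>x \<bullet> (A *v x)\<bar> \<le> norm A * (x \<bullet> x)" for A :: "real^'n^'n"
proof -
  have "\<bar>x \<bullet> (A *v x)\<bar> \<le> norm x * (norm A * norm x)"
    by (rule order_trans[OF Cauchy_Schwarz_ineq2]) (intro mult_left_mono norm_matrix_vector_mult_le norm_ge_zero)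
  then show ?thesis by (simp add: dot_square_norm power2_eq_square mult_ac)
qed

lemma quadratic_form_gram_bounds:
  fixes B :: "real^'n^'m"
  shows "0 \<le> x \<bullet> ((B ** transpose B) *v x)" "x \<bullet> ((B ** transpose B) *v x) \<le> (norm B)\<^sup>2 * (x \<bullet> x)"
proof -
  have eq: "x \<bullet> ((B ** transpose B) *v x) = (norm (transpose B *v x))\<^sup>2"
    using quadratic_form_congruence[of x B "mat 1"] by (simp add: dot_square_norm)
  then show "0 \<le> x \<bullet> ((B ** transpose B) *v x)" by simp
  have "norm (transpose B *v x) \<le> norm B * norm x"
    using norm_matrix_vector_mult_le[of "transpose B" x] by simp
  then show "x \<bullet> ((B ** transpose B) *v x) \<le> (norm B)\<^sup>2 * (x \<bullet> x)"
    unfolding eq by (simp add: dot_square_norm flip: power_mult_distrib)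
qed

lemma psd_congruence: "psd X \<Longrightarrow> psd (B ** X ** transpose B)" for X :: "real^'n^'n" and B :: "real^'n^'m"
  unfolding psd_def by (simp add: quadratic_form_congruence matrix_transpose_mul matrix_mul_assoc del: transpose_matrix_vector)

lemmas quadratic_form_simps =
  matrix_vector_mult_add_rdistrib matrix_vector_mult_diff_rdistrib
  scaleR_matrix_vector_assoc[symmetric] inner_right_distrib inner_diff_right
  inner_scaleR_right matrix_vector_mul_lid

lemma psd_quadratic: "psd X \<Longrightarrow> psd Y \<Longrightarrow> 0 \<le> x \<bullet> ((2 *\<^sub>R (X ** Y ** X)) *v x)"
  for X Y :: "real^'n^'n"
  using quadratic_form_congruence[of x X Y]
  by (simp add: psd_def flip: scaleR_matrix_vector_assoc del: transpose_matrix_vector)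

lemma psd_zero: "psd (0 :: real^'n^'n)"
  by (simp add: psd_def transpose_def vec_eq_iff)

lemma psd_add: "psd X \<Longrightarrow> psd Y \<Longrightarrow> psd (X + Y)" for X Y :: "real^'n^'n"
  by (simp add: psd_def transpose_add matrix_vector_mult_add_rdistrib inner_right_distrib)

section \<open>Inverses of uniformly coercive matrices\<close>

lemma matrix_inv_inverse:
  fixes X :: "real^'n^'n"
  assumes "invertible X"
  shows "X ** matrix_inv X = mat 1" "matrix_inv X ** X = mat 1"
  using someI_ex[OF assms[unfolded invertible_def]] by (simp_all add: matrix_inv_def)

text \<open>A lower bound on the form, rather than invertibility alone: the set is closed, and for
  \<open>c > 0\<close> inversion is bounded and continuous on it, so that it can be composed with
  measurable functions.\<close>

definition coercive_matrices :: "real \<Rightarrow> (real^'n^'n) set" where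
  "coercive_matrices c = {X. \<forall>x. c * (x \<bullet> x) \<le> x \<bullet> (X *v x)}"

lemma closed_coercive_matrices: "closed (coercive_matrices c)"
  unfolding coercive_matrices_def
  by (intro closed_Collect_all closed_Collect_le linear_continuous_on bounded_linear_quadratic_form continuous_on_const)

lemma closed_psd: "closed {X. psd (X :: real^'n^'n)}"
proof -
  have "closed {X :: real^'n^'n. transpose X = X}"
    by (rule closed_Collect_eq[OF linear_continuous_on[OF bounded_linear_transpose] continuous_on_id])
  moreover have "{X. psd (X :: real^'n^'n)} = {X. transpose X = X} \<inter> coercive_matrices 0"
    by (auto simp: psd_def coercive_matrices_def)
  ultimately show ?thesis using closed_coercive_matrices[of 0] by (metis closed_Int)
qed

lemma coercive_invertible:
  assumes "0 < c" "X \<in> coercive_matrices c"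
  shows "invertible X"
  unfolding invertible_left_inverse matrix_left_invertible_ker
proof (intro allI impI)
  fix x assume x: "X *v x = 0"
  have "c * (x \<bullet> x) \<le> x \<bullet> (X *v x)" using assms(2) by (simp add: coercive_matrices_def)
  then have "c * (x \<bullet> x) \<le> 0" by (simp add: x)
  with \<open>0 < c\<close> show "x = 0" by (simp add: mult_le_0_iff dot_square_norm)
qed

text \<open>A column \<open>y\<close> of the inverse solves \<open>X *v y = e\<close> with a unit
  vector \<open>e\<close>. Coercivity gives
  \<open>c * (y \<bullet> y) \<le> y \<bullet> e \<le> norm y\<close>, so every column has norm at
  most \<open>1 / c\<close>.\<close>

lemma norm_coercive_inverse:
  fixes X :: "real^'n^'n"
  assumes c: "0 < c" and X: "X \<in> coercive_matrices c"
  shows "norm (matrix_inv X) \<le> CARD('n) * CARD('n) * (1 / c)"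
proof (rule norm_matrix_le_entries)
  fix i j :: 'n
  define e where "e = (axis j 1 :: real^'n)"
  define y where "y = matrix_inv X *v e"
  have Xy: "X *v y = e"
    by (simp add: y_def matrix_vector_mul_assoc matrix_inv_inverse[OF coercive_invertible[OF c X]])
  have "c * (y \<bullet> y) \<le> y \<bullet> (X *v y)" using X by (simp add: coercive_matrices_def)
  then have "c * (norm y * norm y) \<le> y \<bullet> e" by (simp add: Xy dot_square_norm power2_eq_square)
  also have "\<dots> \<le> norm y" using norm_cauchy_schwarz[of y e] by (simp add: e_def)
  finally have "c * norm y * norm y \<le> 1 * norm y" by (simp add: mult.assoc)
  then have "c * norm y \<le> 1" by (cases "y = 0") simp_all
  moreover have "\<bar>y $ i\<bar> \<le> norm y" by (rule component_le_norm_cart)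
  moreover have "y $ i = matrix_inv X $ i $ j"
    by (simp add: y_def e_def matrix_vector_mult_basis column_def)
  ultimately show "\<bar>matrix_inv X $ i $ j\<bar> \<le> 1 / c"
    using c by (simp add: pos_le_divide_eq mult.commute[of _ c] order_trans[OF mult_left_mono])
qed

text \<open>The substitution \<open>x = X *v y\<close> turns the form of the inverse into that of
  \<open>X\<close>.\<close>

lemma psd_coercive_inverse:
  fixes X :: "real^'n^'n"
  assumes c: "0 < c" and X: "X \<in> coercive_matrices c" and sym: "transpose X = X"
  shows "psd (matrix_inv X)"
proof -
  note inv = matrix_inv_inverse[OF coercive_invertible[OF c X]]
  have "transpose (matrix_inv X) = transpose (matrix_inv X) ** (X ** matrix_inv X)"
    by (simp add: inv)
  also have "\<dots> = transpose (X ** matrix_inv X) ** matrix_inv X"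
    by (simp add: matrix_transpose_mul sym matrix_mul_assoc del: inv)
  also have "\<dots> = matrix_inv X" by (simp add: inv)
  finally have t: "transpose (matrix_inv X) = matrix_inv X" .
  moreover have "0 \<le> x \<bullet> (matrix_inv X *v x)" for x
  proof -
    define y where "y = matrix_inv X *v x"
    have xy: "x = X *v y" by (simp add: y_def matrix_vector_mul_assoc inv)
    have "x \<bullet> (matrix_inv X *v x) = y \<bullet> (X *v y)"
      unfolding y_def[symmetric] by (subst xy) (rule inner_commute)
    moreover have "c * (y \<bullet> y) \<le> y \<bullet> (X *v y)" using X by (simp add: coercive_matrices_def)
    moreover have "0 \<le> c * (y \<bullet> y)" using c by simp
    ultimately show ?thesis by linarith
  qed
  ultimately show ?thesis by (simp add: psd_def)
qed

text \<open>The difference of two inverses is the product of one inverse, the difference of the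
  matrices and the other inverse. With the uniform bound on inverses, inversion is Lipschitz on the
  set.\<close>

lemma continuous_on_coercive_inverse:
  assumes c: "0 < c"
  shows "continuous_on (coercive_matrices c) (matrix_inv :: real^'n^'n \<Rightarrow> real^'n^'n)"
proof -
  define L where "L = CARD('n) * CARD('n) * (1 / c)"
  have "dist (matrix_inv X) (matrix_inv Y) \<le> (L * L) * dist X Y"
    if X: "X \<in> coercive_matrices c" and Y: "Y \<in> coercive_matrices c" for X Y :: "real^'n^'n"
  proof -
    have "matrix_inv X ** (Y - X) ** matrix_inv Y = matrix_inv X - matrix_inv Y"
      by (simp add: matrix_diff_distrib matrix_inv_inverse[OF coercive_invertible[OF c X]]
          matrix_inv_inverse[OF coercive_invertible[OF c Y]] flip: matrix_mul_assoc[of _ Y])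
    moreover have "norm (matrix_inv X ** (Y - X) ** matrix_inv Y) \<le> L * norm (Y - X) * L"
      using norm_coercive_inverse[OF c X] norm_coercive_inverse[OF c Y] c unfolding L_def
      by (intro norm_mult_le) auto
    ultimately show ?thesis by (simp add: dist_norm norm_minus_commute mult_ac)
  qed
  moreover have "0 \<le> L * L" by simp
  ultimately show ?thesis
    by (intro lipschitz_on_continuous_on[of "L * L"] lipschitz_onI)
qed

section \<open>Positivity for delayed linear equations\<close>

text \<open>Time runs down from \<open>T\<close>: \<open>F\<close> is minus the derivative of
  \<open>D\<close>, in integrated form because the coefficients are only measurable. The coefficient
  \<open>e\<close> may be built from \<open>D\<close> itself, which is how quadratic equations are
  covered.\<close>

lemma delayed_positivity:
  fixes D F e b G :: "real \<Rightarrow> real^'n^'n"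
  assumes \<delta>: "0 \<le> \<delta>" and c: "0 \<le> c"
    and \<mu>: "2 * c + 3 * k\<^sup>2 + 1 \<le> \<mu>" "\<mu> * \<delta> \<le> 1"
    and cont: "continuous_on {s..T} D"
    and sol: "\<And>t. t \<in> {s..T} \<Longrightarrow> (F has_integral (D t - D T)) {t..T}"
    and F: "\<And>t. t \<in> {s..T} \<Longrightarrow>
      F t = D t ** transpose (e t) + e t ** D t + b t ** D (t - \<delta>) ** transpose (b t) + G t"
    and e: "\<And>t. t \<in> {s..T} \<Longrightarrow> norm (e t) \<le> c"
    and b: "\<And>t. t \<in> {s..T} \<Longrightarrow> norm (b t) \<le> k"
    and G: "\<And>t x. t \<in> {s..T} \<Longrightarrow> 0 \<le> x \<bullet> (G t *v x)"
    and sym: "\<And>t. t \<in> {s..T} \<Longrightarrow> transpose (D t) = D t"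
    and init: "\<And>t x. t \<in> {s-\<delta>..<s} \<Longrightarrow> 0 \<le> x \<bullet> (D t *v x)"
    and final: "\<And>x. 0 \<le> x \<bullet> (D T *v x)"
    and t: "t \<in> {s..T}"
  shows "psd (D t)"
proof -
  define E where "E t = exp (\<mu> * (T - t))" for t
  define \<phi> where "\<phi> z = (snd z \<bullet> (D (fst z) *v snd z)) / E (fst z)" for z
  have E0: "0 < E t" for t by (simp add: E_def)
  have \<mu>0: "1 \<le> \<mu>" using c \<mu>(1) by (smt (verit) zero_le_power2)
  have E1: "1 \<le> E t" if "t \<le> T" for t using \<mu>0 that by (simp add: E_def)
  have contE: "continuous_on S E" for S unfolding E_def by (intro continuous_intros)
  have derE: "((\<lambda>t. \<mu> * E t) has_integral (E u - E v)) {u..v}" if "u \<le> v" for u v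
  proof -
    have "((\<lambda>t. \<mu> * E t) has_integral (- E v - (- E u))) {u..v}"
      by (rule fundamental_theorem_of_calculus[OF that])
        (auto simp: E_def has_real_derivative_iff_has_vector_derivative[symmetric]
          intro!: derivative_eq_intros)
    then show ?thesis by simp
  qed
  have Edelay: "E (t - \<delta>) \<le> 3 * E t" for t
  proof -
    have "E (t - \<delta>) = E t * exp (\<mu> * \<delta>)"
      by (simp add: E_def algebra_simps flip: exp_add)
    also have "exp (\<mu> * \<delta>) \<le> exp 1" using \<mu> by simp
    also have "exp (1::real) \<le> 3" by (rule exp_le)
    finally show ?thesis using E0[of t] by (simp add: mult.commute)
  qed
  have "continuous_on ({s..T} \<times> sphere 0 1) \<phi>"
    unfolding \<phi>_def
    by (intro continuous_on_divide continuous_on_inner continuous_on_snd continuous_on_id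
        bounded_bilinear.continuous_on[OF bounded_bilinear_matrix_vector_mult]
        continuous_on_compose2[OF cont] continuous_on_compose2[OF contE] continuous_on_fst)
      (auto simp: E_def)
  moreover have "compact ({s..T} \<times> sphere (0::real^'n) 1)"
    by (intro compact_Times) auto
  moreover have "{s..T} \<times> sphere (0::real^'n) 1 \<noteq> {}"
    using t by (simp add: sphere_eq_empty)
  ultimately have "\<exists>z\<in>{s..T} \<times> sphere 0 1. \<forall>y\<in>{s..T} \<times> sphere 0 1. \<phi> z \<le> \<phi> y"
    by (intro continuous_attains_inf)
  then obtain z where z: "z \<in> {s..T} \<times> sphere 0 1"
    and min: "\<And>y. y \<in> {s..T} \<times> sphere 0 1 \<Longrightarrow> \<phi> z \<le> \<phi> y"
    by auto
  obtain t0 x0 where z_eq: "z = (t0, x0)" by (cases z)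
  have t0: "s \<le> t0" "t0 \<le> T" and x0: "norm x0 = 1" using z z_eq by auto
  have x0x0: "x0 \<bullet> x0 = 1" using x0 by (simp add: dot_square_norm)
  \<comment> \<open>With this sign, \<open>lower\<close> says that \<open>D r\<close> plus
    \<open>\<eta> * E r\<close> times the identity is nonnegative at all times, with equality of the
    form at \<open>t0\<close> and \<open>x0\<close>.\<close>
  define \<eta> where "\<eta> = - \<phi> z"
  have lower: "- \<eta> * E r * (x \<bullet> x) \<le> x \<bullet> (D r *v x)" if r: "r \<in> {s..T}" for r x
  proof (cases "x = 0")
    case False
    define y where "y = x /\<^sub>R norm x"
    have "- \<eta> \<le> \<phi> (r, y)" using min[of "(r, y)"] r False by (simp add: \<eta>_def y_def)
    then have "- \<eta> * E r \<le> y \<bullet> (D r *v y)" using E0[of r] by (simp add: \<phi>_def field_simps)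
    moreover have "y \<bullet> (D r *v y) = (x \<bullet> (D r *v x)) / (x \<bullet> x)"
      by (simp add: y_def matrix_vector_mult_scaleR dot_square_norm power2_eq_square divide_inverse)
    ultimately show ?thesis using False by (simp add: field_simps)
  qed simp
  have "\<eta> \<le> 0"
  proof (rule ccontr)
    assume "\<not> \<eta> \<le> 0"
    then have \<eta>: "0 < \<eta>" by simp
    have min0: "x0 \<bullet> (D t0 *v x0) = - \<eta> * E t0"
      using E0[of t0] by (simp add: \<eta>_def \<phi>_def z_eq)
    \<comment> \<open>The terminal value is nonnegative, so a negative minimum is attained before
      \<open>T\<close> and there is room to the right of \<open>t0\<close>.\<close>
    have "t0 \<noteq> T" using final[of x0] min0 \<eta> E0[of t0] by (metis mult_minus_left mult_pos_pos neg_0_le_iff_le not_le)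
    then have t0T: "t0 < T" using t0 by simp
    \<comment> \<open>This vector vanishes at \<open>t0\<close> by \<open>psd_null\<close>. Near
      \<open>t0\<close> it allows \<open>D r *v x0\<close> to be replaced by a multiple of
      \<open>x0\<close>; the threshold \<open>\<eta> / (4 * (c + 1))\<close> makes the error at most
      \<open>\<eta> / 4\<close> after pairing with \<open>w\<close>.\<close>
    define v where "v r = D r *v x0 + (\<eta> * E r) *\<^sub>R x0" for r
    have "0 \<le> x \<bullet> (D t0 *v x) + \<eta> * E t0 * (x \<bullet> x)" for x
      using lower[of t0 x] t0 by simp
    then have "psd (D t0 + (\<eta> * E t0) *\<^sub>R mat 1)"
      using sym[of t0] t0
      by (simp add: psd_def transpose_add transpose_scalar matrix_vector_mult_add_rdistrib inner_right_distrib
          flip: scaleR_matrix_vector_assoc)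
    then have "v t0 = 0"
      unfolding v_def using min0 x0x0
      by (subst psd_null[of "D t0 + (\<eta> * E t0) *\<^sub>R mat 1" x0, symmetric])
        (simp_all add: matrix_vector_mult_add_rdistrib inner_right_distrib
          flip: scaleR_matrix_vector_assoc)
    moreover have "continuous_on {s..T} v"
      unfolding v_def by (intro continuous_intros contE
          bounded_bilinear.continuous_on[OF bounded_bilinear_matrix_vector_mult] cont)
    moreover have "0 < \<eta> / (4 * (c + 1))" using \<eta> c by simp
    ultimately obtain d where d: "d > 0"
      and dv: "\<And>r. r \<in> {s..T} \<Longrightarrow> dist r t0 < d \<Longrightarrow> norm (v r) < \<eta> / (4 * (c + 1))"
      using t0 unfolding continuous_on_iff by (metis atLeastAtMost_iff dist_0_norm dist_commute)
    define t1 where "t1 = min T (t0 + d / 2)"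
    have t1: "t0 < t1" "t1 \<le> T" using t0T d by (auto simp: t1_def)
    \<comment> \<open>In units of \<open>\<eta> * E r\<close>, the two terms with \<open>e\<close>
      cost \<open>2 * c\<close>, the delayed term \<open>3 * k\<^sup>2\<close> and the two errors
      from \<open>v\<close> together \<open>1 / 2\<close>. The \<open>1\<close> in the condition on
      \<open>\<mu>\<close> leaves one half to spare, which is the gain
      \<open>1 / (2 * \<mu>)\<close>.\<close>
    have ptw: "- ((1 - 1 / (2 * \<mu>)) * \<eta>) * (\<mu> * E r) \<le> x0 \<bullet> (F r *v x0)" if r: "r \<in> {t0..t1}" for r
    proof -
      have rI: "r \<in> {s..T}" using r t0 t1 by auto
      define y where "y = transpose (b r) *v x0"
      define w where "w = transpose (e r) *v x0"
      have nw: "norm w \<le> c"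
        using norm_matrix_vector_mult_le[of "transpose (e r)" x0] e[OF rI] x0 by (simp add: w_def)
      have ny: "norm y \<le> k"
        using norm_matrix_vector_mult_le[of "transpose (b r)" x0] b[OF rI] x0 by (simp add: y_def)
      have F1: "x0 \<bullet> ((D r ** transpose (e r)) *v x0) = w \<bullet> (D r *v x0)"
        by (metis inner_commute inner_transpose_mult matrix_vector_mul_assoc rI sym w_def)
      have F2: "x0 \<bullet> ((e r ** D r) *v x0) = w \<bullet> (D r *v x0)"
        by (metis inner_transpose_mult matrix_vector_mul_assoc transpose_transpose w_def)
      have F3: "x0 \<bullet> ((b r ** D (r - \<delta>) ** transpose (b r)) *v x0) = y \<bullet> (D (r - \<delta>) *v y)"
        unfolding y_def by (rule quadratic_form_congruence)
      have "norm (v r) < \<eta> / (4 * (c + 1))"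
        using r rI d by (intro dv) (auto simp: t1_def dist_real_def)
      moreover have "\<bar>w \<bullet> v r\<bar> \<le> c * norm (v r)"
        using Cauchy_Schwarz_ineq2[of w "v r"] nw by (meson mult_right_mono norm_ge_zero order_trans)
      ultimately have "\<bar>w \<bullet> v r\<bar> \<le> c * (\<eta> / (4 * (c + 1)))"
        using c by (meson less_imp_le mult_left_mono order_trans)
      also have "\<dots> \<le> \<eta> / 4" using c \<eta> by (simp add: field_simps)
      finally have "\<bar>w \<bullet> v r\<bar> \<le> \<eta> / 4" .
      moreover have "w \<bullet> v r = w \<bullet> (D r *v x0) + \<eta> * E r * (w \<bullet> x0)"
        by (simp add: v_def inner_right_distrib)
      moreover have "\<eta> * E r * (w \<bullet> x0) \<le> \<eta> * E r * c"
        using Cauchy_Schwarz_ineq2[of w x0] nw x0 \<eta> E0[of r] by (intro mult_left_mono) auto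
      moreover have "\<eta> \<le> \<eta> * E r" using E1[of r] rI \<eta> by simp
      ultimately have W: "- (\<eta> * E r / 4) - \<eta> * E r * c \<le> w \<bullet> (D r *v x0)" by linarith
      have "- 3 * \<eta> * E r * k\<^sup>2 \<le> y \<bullet> (D (r - \<delta>) *v y)"
      proof (cases "r - \<delta> < s")
        case True
        then have "0 \<le> y \<bullet> (D (r - \<delta>) *v y)" using rI by (intro init) auto
        moreover have "0 \<le> 3 * \<eta> * E r * k\<^sup>2" using \<eta> E0[of r] by simp
        ultimately show ?thesis by linarith
      next
        case False
        then have "- \<eta> * E (r - \<delta>) * (y \<bullet> y) \<le> y \<bullet> (D (r - \<delta>) *v y)"
          using rI \<delta> by (intro lower) auto
        moreover have "E (r - \<delta>) * (y \<bullet> y) \<le> (3 * E r) * k\<^sup>2"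
          using ny E0[of r] by (intro mult_mono Edelay) (auto simp: dot_square_norm power_mono)
        then have "\<eta> * (E (r - \<delta>) * (y \<bullet> y)) \<le> \<eta> * ((3 * E r) * k\<^sup>2)"
          using \<eta> by (intro mult_left_mono) auto
        ultimately show ?thesis by (simp add: mult_ac)
      qed
      moreover have "x0 \<bullet> (F r *v x0) = 2 * (w \<bullet> (D r *v x0)) + y \<bullet> (D (r - \<delta>) *v y) + x0 \<bullet> (G r *v x0)"
        by (simp add: F[OF rI] matrix_vector_mult_add_rdistrib inner_right_distrib F1 F2 F3)
      ultimately have "- (\<eta> * E r / 2) - 2 * (\<eta> * E r * c) - 3 * \<eta> * E r * k\<^sup>2 \<le> x0 \<bullet> (F r *v x0)"
        using W G[OF rI, of x0] by linarith
      moreover have "(\<eta> * E r) * (2 * c + 3 * k\<^sup>2 + 1) \<le> (\<eta> * E r) * \<mu>"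
        using \<eta> E0[of r] \<mu> by (intro mult_left_mono) auto
      moreover have "((1 - 1 / (2 * \<mu>)) * \<eta>) * (\<mu> * E r) = (\<eta> * E r) * \<mu> - \<eta> * E r / 2"
        using \<mu>0 by (simp add: field_simps)
      ultimately show ?thesis by (simp add: algebra_simps)
    qed
    have "(F has_integral (D t0 - D t1)) {t0..t1}"
    proof -
      have "F integrable_on {t0..T}" using sol[of t0] t0 by (auto simp: integrable_on_def)
      then have "F integrable_on {t0..t1}"
        by (rule integrable_on_subinterval) (use t1 in auto)
      moreover have "integral {t0..t1} F + integral {t1..T} F = integral {t0..T} F"
        by (rule Henstock_Kurzweil_Integration.integral_combine) (use t1 \<open>F integrable_on {t0..T}\<close> in auto)
      ultimately show ?thesis
        using sol[of t0] sol[of t1] t0 t1 by (simp add: has_integral_integrable_integral) (metis add_diff_cancel_right')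
    qed
    from has_integral_linear[OF this bounded_linear_quadratic_form[of x0]]
    have I: "((\<lambda>r. x0 \<bullet> (F r *v x0)) has_integral (x0 \<bullet> ((D t0 - D t1) *v x0))) {t0..t1}"
      by (simp add: o_def)
    have "((\<lambda>r. - ((1 - 1 / (2 * \<mu>)) * \<eta>) * (\<mu> * E r)) has_integral
        - ((1 - 1 / (2 * \<mu>)) * \<eta>) * (E t0 - E t1)) {t0..t1}"
      by (intro has_integral_mult_right derE) (use t1 in auto)
    \<comment> \<open>Minimality at \<open>t1\<close> bounds the same difference above by
      \<open>- \<eta> * (E t0 - E t1)\<close>. Since \<open>E\<close> is strictly decreasing, the
      factor below one on the left is a contradiction.\<close>
    then have "- ((1 - 1 / (2 * \<mu>)) * \<eta>) * (E t0 - E t1) \<le> x0 \<bullet> ((D t0 - D t1) *v x0)"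
      by (rule has_integral_le[OF _ I]) (use ptw in auto)
    also have "\<dots> \<le> - \<eta> * E t0 + \<eta> * E t1"
      using lower[of t1 x0] t0 t1 min0 x0x0 by (simp add: matrix_vector_mult_diff_rdistrib inner_diff_right)
    finally have "1 / (2 * \<mu>) * \<eta> * (E t0 - E t1) \<le> 0"
      by (simp add: algebra_simps)
    moreover have "0 < 1 / (2 * \<mu>) * \<eta> * (E t0 - E t1)"
      using \<mu>0 \<eta> t1 by (intro mult_pos_pos) (auto simp: E_def)
    ultimately show False by linarith
  qed
  then have "0 \<le> - \<eta> * E t * (x \<bullet> x)" for x
    using E0[of t] by (intro mult_nonneg_nonneg) (auto intro: less_imp_le)
  then show ?thesis
    using lower[OF t] sym[OF t] unfolding psd_def by (meson order_trans)
qed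

section \<open>Terminal value problems as fixed points\<close>

text \<open>The integral of the weight \<open>exp (\<mu> * (T - r))\<close> over
  \<open>{t..T}\<close> is less than its value at \<open>t\<close> divided by \<open>\<mu>\<close>,
  so the Lipschitz constant \<open>\<mu> / 2\<close> becomes the factor
  \<open>1 / 2\<close>.\<close>

lemma weighted_contraction_integral:
  fixes f g :: "real \<Rightarrow> 'a::euclidean_space"
  assumes \<mu>: "0 < \<mu>" and "0 \<le> c" and t: "t \<le> T"
    and f: "f integrable_on {t..T}" and g: "g integrable_on {t..T}"
    and le: "\<And>r. r \<in> {t..T} \<Longrightarrow> norm (f r - g r) \<le> \<mu> / 2 * c * exp (\<mu> * (T - r))"
  shows "norm (integral {t..T} f - integral {t..T} g) \<le> c / 2 * exp (\<mu> * (T - t))"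
proof -
  have E: "((\<lambda>r. \<mu> / 2 * c * exp (\<mu> * (T - r))) has_integral
      (- (c / 2) * exp (\<mu> * (T - T)) - - (c / 2) * exp (\<mu> * (T - t)))) {t..T}"
    by (rule fundamental_theorem_of_calculus[OF t])
      (auto simp: has_real_derivative_iff_has_vector_derivative[symmetric]
        intro!: derivative_eq_intros)
  have "norm (integral {t..T} (\<lambda>r. f r - g r)) \<le> integral {t..T} (\<lambda>r. \<mu> / 2 * c * exp (\<mu> * (T - r)))"
    using le by (intro integral_norm_bound_integral integrable_diff f g has_integral_integrable[OF E])
  also have "\<dots> = - (c / 2) * exp (\<mu> * (T - T)) - - (c / 2) * exp (\<mu> * (T - t))"
    using E by (rule integral_unique)
  also have "\<dots> \<le> c / 2 * exp (\<mu> * (T - t))" using \<open>0 \<le> c\<close> by simp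
  finally show ?thesis using f g by (simp add: Henstock_Kurzweil_Integration.integral_diff)
qed

text \<open>Banach's fixed point theorem in a weighted sup norm. \<open>G\<close> acts on whole
  functions rather than on values, so that delayed arguments are allowed.\<close>

lemma terminal_integral_equation_exists:
  fixes G :: "(real \<Rightarrow> 'a::euclidean_space) \<Rightarrow> real \<Rightarrow> 'a"
  assumes sT: "s \<le> T" and \<mu>: "0 < \<mu>"
    and int: "\<And>Y. continuous_on {s..T} Y \<Longrightarrow> G Y integrable_on {s..T}"
    and lip: "\<And>Y Z c t. continuous_on {s..T} Y \<Longrightarrow> continuous_on {s..T} Z \<Longrightarrow> 0 \<le> c \<Longrightarrow>
      (\<And>r. r \<in> {s..T} \<Longrightarrow> norm (Y r - Z r) \<le> c * exp (\<mu> * (T - r))) \<Longrightarrow> t \<in> {s..T} \<Longrightarrow>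
      norm (G Y t - G Z t) \<le> \<mu> / 2 * c * exp (\<mu> * (T - t))"
  shows "\<exists>Y. continuous_on {s..T} Y \<and> (\<forall>t\<in>{s..T}. Y t = M + integral {t..T} (G Y))"
proof -
  \<comment> \<open>The unknown is divided by the weight, which turns the weighted norm into the
    plain sup norm on the complete type of bounded continuous functions. Below, \<open>clamp\<close>
    extends functions from \<open>{s..T}\<close> to the whole line.\<close>
  define L where "L u t = exp (\<mu> * (T - t)) *\<^sub>R apply_bcontfun u t" for u :: "real \<Rightarrow>\<^sub>C 'a" and t
  define V where "V u t = exp (- (\<mu> * (T - t))) *\<^sub>R (M + integral {t..T} (G (L u)))" for u t
  have contL: "continuous_on {s..T} (L u)" for u
    unfolding L_def by (intro continuous_intros continuous_on_apply_bcontfun)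
  have "\<exists>w :: real \<Rightarrow>\<^sub>C 'a. \<forall>t. apply_bcontfun w t = V u (clamp s T t)" for u
  proof -
    have "continuous_on (cbox s T) (V u)"
      unfolding V_def cbox_interval
      by (intro continuous_intros indefinite_integral_continuous_1' int contL)
    moreover from this have "bounded (V u ` cbox s T)"
      by (intro compact_imp_bounded compact_continuous_image compact_cbox)
    ultimately have "(\<lambda>t. V u (clamp s T t)) \<in> bcontfun"
      unfolding bcontfun_def using clamp_continuous_on clamp_bounded by blast
    then show ?thesis by (metis bcontfunE)
  qed
  then obtain F :: "(real \<Rightarrow>\<^sub>C 'a) \<Rightarrow> real \<Rightarrow>\<^sub>C 'a"
    where F: "\<And>u t. apply_bcontfun (F u) t = V u (clamp s T t)" by metis
  have "dist (F u) (F w) \<le> 1 / 2 * dist u w" for u w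
  proof (rule dist_bound)
    fix t
    define r where "r = clamp s T t"
    have r: "r \<in> {s..T}" using clamp_in_interval[of s T t] sT by (simp add: r_def cbox_interval)
    have "norm (L u q - L w q) \<le> dist u w * exp (\<mu> * (T - q))" for q
      using dist_bounded[of u q w]
      by (simp add: L_def dist_norm flip: scaleR_diff_right)
    then have lipL: "norm (G (L u) q - G (L w) q) \<le> \<mu> / 2 * dist u w * exp (\<mu> * (T - q))"
      if "q \<in> {s..T}" for q
      by (intro lip contL that) auto
    define e where "e = exp (\<mu> * (T - r))"
    have e: "0 < e" by (simp add: e_def)
    have "norm (integral {r..T} (G (L u)) - integral {r..T} (G (L w))) \<le> dist u w / 2 * e"
      unfolding e_def using r
      by (intro weighted_contraction_integral \<mu> integrable_on_subinterval[OF int[OF contL]] lipL) auto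
    then have "norm (integral {r..T} (G (L u)) - integral {r..T} (G (L w))) / e \<le> dist u w / 2"
      using e by (simp add: divide_le_eq)
    moreover have "dist (F u t) (F w t) = norm (integral {r..T} (G (L u)) - integral {r..T} (G (L w))) / e"
      by (simp add: F V_def dist_norm e_def exp_minus divide_inverse flip: r_def scaleR_diff_right)
    ultimately show "dist (F u t) (F w t) \<le> 1 / 2 * dist u w"
      by simp
  qed
  then have "\<exists>!u. F u = u" by (intro banach_fix_type[of "1/2"]) auto
  then obtain u where u: "F u = u" by auto
  have "L u t = M + integral {t..T} (G (L u))" if "t \<in> {s..T}" for t
  proof -
    have "apply_bcontfun u t = V u t"
      using F[of u t] u clamp_cancel_cbox[of t s T] that by (simp add: cbox_interval)
    then show ?thesis by (simp add: L_def[of u t] V_def exp_minus)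
  qed
  with contL show ?thesis by blast
qed

text \<open>At a time where the weighted distance of two solutions is largest, the contraction
  estimate bounds that maximum by half of itself.\<close>

lemma terminal_integral_equation_unique:
  fixes G :: "(real \<Rightarrow> 'a::euclidean_space) \<Rightarrow> real \<Rightarrow> 'a"
  assumes \<mu>: "0 < \<mu>"
    and int: "\<And>Y. continuous_on {s..T} Y \<Longrightarrow> G Y integrable_on {s..T}"
    and lip: "\<And>Y Z c t. continuous_on {s..T} Y \<Longrightarrow> continuous_on {s..T} Z \<Longrightarrow> 0 \<le> c \<Longrightarrow>
      (\<And>r. r \<in> {s..T} \<Longrightarrow> norm (Y r - Z r) \<le> c * exp (\<mu> * (T - r))) \<Longrightarrow> t \<in> {s..T} \<Longrightarrow>
      norm (G Y t - G Z t) \<le> \<mu> / 2 * c * exp (\<mu> * (T - t))"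
    and Y: "continuous_on {s..T} Y" "\<And>t. t \<in> {s..T} \<Longrightarrow> Y t = M + integral {t..T} (G Y)"
    and Z: "continuous_on {s..T} Z" "\<And>t. t \<in> {s..T} \<Longrightarrow> Z t = M + integral {t..T} (G Z)"
    and t: "t \<in> {s..T}"
  shows "Y t = Z t"
proof -
  define \<phi> where "\<phi> r = norm (Y r - Z r) / exp (\<mu> * (T - r))" for r
  have "continuous_on {s..T} \<phi>"
    unfolding \<phi>_def by (intro continuous_intros Y Z) auto
  then have "\<exists>q\<in>{s..T}. \<forall>r\<in>{s..T}. \<phi> r \<le> \<phi> q"
    using t by (intro continuous_attains_sup) auto
  then obtain q where q: "q \<in> {s..T}" and max: "\<And>r. r \<in> {s..T} \<Longrightarrow> \<phi> r \<le> \<phi> q" by auto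
  have \<phi>0: "0 \<le> \<phi> q" by (simp add: \<phi>_def)
  have "norm (Y r - Z r) \<le> \<phi> q * exp (\<mu> * (T - r))" if "r \<in> {s..T}" for r
    using max[OF that] by (simp add: \<phi>_def[of r] field_simps)
  then have "norm (G Y r - G Z r) \<le> \<mu> / 2 * \<phi> q * exp (\<mu> * (T - r))" if "r \<in> {s..T}" for r
    by (intro lip Y(1) Z(1) \<phi>0 that) auto
  then have "norm (integral {q..T} (G Y) - integral {q..T} (G Z)) \<le> \<phi> q / 2 * exp (\<mu> * (T - q))"
    using q by (intro weighted_contraction_integral \<mu> \<phi>0
        integrable_on_subinterval[OF int[OF Y(1)]] integrable_on_subinterval[OF int[OF Z(1)]]) auto
  then have "\<phi> q \<le> \<phi> q / 2"
    using Y(2)[OF q] Z(2)[OF q] by (simp add: \<phi>_def field_simps)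
  then have "\<phi> t \<le> 0" using max[OF t] by simp
  then show ?thesis by (simp add: \<phi>_def divide_le_0_iff)
qed

lemma has_integral_exp_weight:
  fixes c :: real
  assumes "t \<le> T"
  shows "((\<lambda>r. \<nu> * c * exp (\<nu> * (T - r))) has_integral c * exp (\<nu> * (T - t)) - c) {t..T}"
proof -
  have "((\<lambda>r. \<nu> * c * exp (\<nu> * (T - r))) has_integral
      (- c * exp (\<nu> * (T - T)) - - c * exp (\<nu> * (T - t)))) {t..T}"
    by (rule fundamental_theorem_of_calculus[OF assms])
      (auto simp: has_real_derivative_iff_has_vector_derivative[symmetric]
        intro!: derivative_eq_intros)
  then show ?thesis by simp
qed

section \<open>Bounded measurable functions\<close>

text \<open>The bound is left unnamed because this notion serves integrability only;
  \<open>bounded_measurable\<close> carries the explicit constants from which the admissible delay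
  is computed.\<close>

definition bounded_meas :: "real set \<Rightarrow> (real \<Rightarrow> 'a::euclidean_space) \<Rightarrow> bool" where
  "bounded_meas I f \<longleftrightarrow> f \<in> borel_measurable (lebesgue_on I) \<and> bounded (f ` I)"

lemma bounded_measurable_imp_bounded_meas: "bounded_measurable K I f \<Longrightarrow> bounded_meas I f"
  unfolding bounded_measurable_def bounded_meas_def bounded_iff by auto

lemma bounded_meas_bilinear:
  assumes h: "bounded_bilinear h" and f: "bounded_meas I f" and g: "bounded_meas I g"
  shows "bounded_meas I (\<lambda>t. h (f t) (g t))"
proof -
  have "continuous_on UNIV (\<lambda>z. h (fst z) (snd z))"
    using continuous_on_fst[OF continuous_on_id] continuous_on_snd[OF continuous_on_id]
    by (rule bounded_bilinear.continuous_on[OF h])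
  then have "(\<lambda>t. h (f t) (g t)) \<in> borel_measurable (lebesgue_on I)"
    using f g unfolding bounded_meas_def by (intro borel_measurable_continuous_Pair[where H=h]) auto
  moreover obtain B C where B: "\<forall>t\<in>I. norm (f t) \<le> B" "\<forall>t\<in>I. norm (g t) \<le> C"
    using f g unfolding bounded_meas_def bounded_iff by auto
  obtain K where "K \<ge> 0" "\<And>x y. norm (h x y) \<le> norm x * norm y * K"
    using bounded_bilinear.nonneg_bounded[OF h] by auto
  then have "norm (h (f t) (g t)) \<le> B * C * K" if "t \<in> I" for t
    using B that by (smt (verit) mult_mono norm_ge_zero mult_nonneg_nonneg)
  then have "bounded ((\<lambda>t. h (f t) (g t)) ` I)"
    unfolding bounded_iff by auto
  ultimately show ?thesis by (simp add: bounded_meas_def)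
qed

lemma bounded_meas_linear:
  fixes h :: "'a::euclidean_space \<Rightarrow> 'b::euclidean_space"
  assumes h: "bounded_linear h" and f: "bounded_meas I f"
  shows "bounded_meas I (\<lambda>t. h (f t))"
proof -
  have "h \<in> borel_measurable borel"
    by (intro borel_measurable_continuous_onI linear_continuous_on h)
  then have "(\<lambda>t. h (f t)) \<in> borel_measurable (lebesgue_on I)"
    using f unfolding bounded_meas_def by auto
  moreover have "bounded ((\<lambda>t. h (f t)) ` I)"
    using bounded_linear_image[OF _ h, of "f ` I"] f by (simp add: bounded_meas_def image_image)
  ultimately show ?thesis by (simp add: bounded_meas_def)
qed

lemma bounded_meas_add:
  assumes "bounded_meas I f" "bounded_meas I g"
  shows "bounded_meas I (\<lambda>t. f t + g t)" "bounded_meas I (\<lambda>t. f t - g t)"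
  using assms unfolding bounded_meas_def
  by (auto intro: borel_measurable_add borel_measurable_diff bounded_plus_comp bounded_minus_comp)

lemmas bounded_meas_intros =
  bounded_meas_add
  bounded_meas_bilinear[OF bounded_bilinear_matrix_mult]
  bounded_meas_linear[OF bounded_linear_transpose]
  bounded_meas_linear[OF bounded_linear_scaleR_right]

lemma bounded_meas_abs_integrable:
  assumes "bounded_meas {u..v} f"
  shows "f absolutely_integrable_on {u..v}"
proof -
  obtain B where "\<forall>t\<in>{u..v}. norm (f t) \<le> B"
    using assms unfolding bounded_meas_def bounded_iff by auto
  then show ?thesis
    using assms unfolding bounded_meas_def
    by (intro measurable_bounded_by_integrable_imp_absolutely_integrable[where g="\<lambda>_. B"]) auto
qed

lemma bounded_meas_continuous:
  fixes f :: "real \<Rightarrow> 'a::euclidean_space"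
  assumes "continuous_on {u..v} f"
  shows "bounded_meas {u..v} f"
  using assms unfolding bounded_meas_def
  by (auto intro: continuous_imp_measurable_on_sets_lebesgue compact_imp_bounded
      compact_continuous_image)

text \<open>The history need not match \<open>X s\<close>, so the delayed function may jump at
  \<open>t = s + \<delta>\<close>. It is measurable as a case distinction between a constant and a
  continuous function, the latter extended by \<open>clamp\<close>.\<close>

lemma bounded_meas_delayed:
  fixes X :: "real \<Rightarrow> 'a::euclidean_space"
  assumes X: "continuous_on {s..T} X" and \<delta>: "0 \<le> \<delta>" and sT: "s \<le> T"
  shows "bounded_meas {s..T} (\<lambda>t. if t - \<delta> < s then x0 else X (t - \<delta>))"
proof -
  define f where "f t = (if t - \<delta> < s then x0 else X (clamp s T (t - \<delta>)))" for t
  have "continuous_on UNIV (\<lambda>t. X (clamp s T t))"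
    using X clamp_continuous_on[of s T X UNIV] by (simp add: cbox_interval)
  then have "(\<lambda>t. X (clamp s T (t - \<delta>))) \<in> borel_measurable borel"
    by (intro borel_measurable_continuous_onI)
      (rule continuous_on_compose2[where g="\<lambda>t. X (clamp s T t)"], auto intro!: continuous_intros)
  then have "f \<in> borel_measurable borel"
    unfolding f_def by measurable
  then have "f \<in> borel_measurable (lebesgue_on {s..T})"
    by (intro measurable_restrict_space1 measurable_completion) simp
  moreover have "f t = (if t - \<delta> < s then x0 else X (t - \<delta>))" if "t \<in> {s..T}" for t
    using that \<delta> clamp_cancel_cbox[of "t - \<delta>" s T] by (auto simp: f_def cbox_interval)
  ultimately have "(\<lambda>t. if t - \<delta> < s then x0 else X (t - \<delta>)) \<in> borel_measurable (lebesgue_on {s..T})"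
    by (subst (asm) measurable_lebesgue_cong) auto
  moreover have "bounded (insert x0 (X ` {s..T}))"
    using X by (simp add: compact_imp_bounded compact_continuous_image)
  then have "bounded ((\<lambda>t. if t - \<delta> < s then x0 else X (t - \<delta>)) ` {s..T})"
    by (rule bounded_subset) (use \<delta> in auto)
  ultimately show ?thesis by (simp add: bounded_meas_def)
qed

text \<open>Projection onto a centred ball is radial. The general theory of projections gives the
  Lipschitz constant one; this formula shows that symmetry and positivity are kept.\<close>

lemma closest_point_cball_0:
  fixes Y :: "'a::euclidean_space"
  assumes "0 \<le> \<rho>"
  shows "closest_point (cball 0 \<rho>) Y = (if norm Y \<le> \<rho> then 1 else \<rho> / norm Y) *\<^sub>R Y"
proof -
  define c where "c = (if norm Y \<le> \<rho> then 1 else \<rho> / norm Y)"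
  have "c *\<^sub>R Y = closest_point (cball 0 \<rho>) Y"
  proof (rule closest_point_unique)
    show "\<forall>z\<in>cball 0 \<rho>. dist Y (c *\<^sub>R Y) \<le> dist Y z"
    proof
      fix z :: 'a assume z: "z \<in> cball 0 \<rho>"
      have "dist Y (c *\<^sub>R Y) = norm ((1 - c) *\<^sub>R Y)" by (simp add: dist_norm algebra_simps)
      also have "\<dots> = \<bar>1 - c\<bar> * norm Y" by simp
      also have "\<dots> = max 0 (norm Y - \<rho>)"
        using assms by (auto simp: c_def abs_if left_diff_distrib)
      also have "\<dots> \<le> dist Y z"
        using z norm_triangle_sub[of Y z] by (auto simp: dist_norm)
      finally show "dist Y (c *\<^sub>R Y) \<le> dist Y z" .
    qed
  qed (use assms in \<open>auto simp: c_def\<close>)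
  then show ?thesis by (simp add: c_def)
qed

section \<open>Translations, cut-offs and exceptional null sets\<close>

lemma measurable_lebesgue_translation: "(\<lambda>t::real. t + d) \<in> lebesgue \<rightarrow>\<^sub>M lebesgue"
  using lebesgue_affine_measurable[of "\<lambda>_::real. 1" d] by (simp add: add.commute)

lemma bounded_measurable_shift:
  assumes f: "bounded_measurable K {u..v} f" and "u \<le> u' + d" "v' + d \<le> v"
  shows "bounded_measurable K {u'..v'} (\<lambda>t. f (t + d))"
proof -
  have "(\<lambda>t. t + d) \<in> lebesgue_on {u'..v'} \<rightarrow>\<^sub>M lebesgue_on {u..v}"
    by (intro measurable_restrict_space2 measurable_restrict_space1 measurable_lebesgue_translation)
      (use assms in \<open>auto simp: space_restrict_space\<close>)
  then have "(\<lambda>t. f (t + d)) \<in> borel_measurable (lebesgue_on {u'..v'})"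
    using f unfolding bounded_measurable_def by (auto intro: measurable_compose)
  then show ?thesis using f assms unfolding bounded_measurable_def by auto
qed

lemma bounded_measurable_mono:
  "bounded_measurable K I f \<Longrightarrow> J \<subseteq> I \<Longrightarrow> K \<le> L \<Longrightarrow> bounded_measurable L J f"
  unfolding bounded_measurable_def by (meson measurable_restrict_mono order_trans subsetD)

lemma bounded_measurable_add:
  "bounded_measurable K I f \<Longrightarrow> bounded_measurable L I g \<Longrightarrow> bounded_measurable (K + L) I (\<lambda>t. f t + g t)"
  unfolding bounded_measurable_def by (auto intro!: norm_triangle_le add_mono)

lemma bounded_measurable_const: "norm c \<le> K \<Longrightarrow> bounded_measurable K I (\<lambda>_. c)"
  unfolding bounded_measurable_def by auto

lemma bounded_measurable_scaleR:
  "bounded_measurable K I f \<Longrightarrow> bounded_measurable (\<bar>c\<bar> * K) I (\<lambda>t. c *\<^sub>R f t)"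
  unfolding bounded_measurable_def by (auto intro!: mult_left_mono)

lemma bounded_measurable_congruence:
  fixes C :: "real \<Rightarrow> real^'d^'n"
  assumes C: "bounded_measurable K I C" and X: "bounded_measurable L I X" and "0 \<le> K" "0 \<le> L"
  shows "bounded_measurable (K * L * K) I (\<lambda>t. C t ** X t ** transpose (C t))"
proof -
  have m: "C \<in> borel_measurable (lebesgue_on I)" "X \<in> borel_measurable (lebesgue_on I)"
    using C X by (auto simp: bounded_measurable_def)
  note pair = bounded_bilinear.continuous_on[OF bounded_bilinear_matrix_mult]
  have "(\<lambda>t. C t ** X t) \<in> borel_measurable (lebesgue_on I)"
    by (rule borel_measurable_continuous_Pair[OF m])
      (rule pair[OF continuous_on_fst[OF continuous_on_id] continuous_on_snd[OF continuous_on_id]])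
  moreover have "(\<lambda>t. transpose (C t)) \<in> borel_measurable (lebesgue_on I)"
    using m(1) by (rule measurable_compose)
      (rule borel_measurable_continuous_onI[OF linear_continuous_on[OF bounded_linear_transpose]])
  ultimately have "(\<lambda>t. C t ** X t ** transpose (C t)) \<in> borel_measurable (lebesgue_on I)"
    by (rule borel_measurable_continuous_Pair)
      (rule pair[OF continuous_on_fst[OF continuous_on_id] continuous_on_snd[OF continuous_on_id]])
  moreover have "norm (C t ** X t ** transpose (C t)) \<le> K * L * K" if "t \<in> I" for t
    using C X that assms unfolding bounded_measurable_def by (intro norm_mult_le) auto
  ultimately show ?thesis by (simp add: bounded_measurable_def)
qed

text \<open>Although \<open>g\<close> is continuous only on \<open>S\<close>, its product with the
  indicator of the closed set is a Borel function on the whole space. This is how the matrix inverse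
  is made measurable.\<close>

lemma bounded_measurable_indicator_compose:
  fixes g :: "'a::euclidean_space \<Rightarrow> 'b::euclidean_space"
  assumes f: "f \<in> borel_measurable (lebesgue_on I)" and S: "closed S" and g: "continuous_on S g"
    and le: "\<And>t. t \<in> I \<Longrightarrow> f t \<in> S \<Longrightarrow> norm (g (f t)) \<le> L" "0 \<le> L"
  shows "bounded_measurable L I (\<lambda>t. indicator S (f t) *\<^sub>R g (f t))"
proof -
  have "(\<lambda>x. indicator S x *\<^sub>R g x) \<in> borel_measurable borel"
    using S g by (intro borel_measurable_continuous_on_indicator) auto
  from measurable_compose[OF f this] show ?thesis
    using le by (auto simp: bounded_measurable_def indicator_def)
qed

lemma AE_lebesgue_negligible:
  assumes "AE t in lebesgue. P (t::real)"
  obtains N where "negligible N" "\<And>t. t \<notin> N \<Longrightarrow> P t"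
proof -
  from assms obtain N where "N \<in> null_sets lebesgue" "{t \<in> space lebesgue. \<not> P t} \<subseteq> N"
    unfolding eventually_ae_filter by blast
  then show ?thesis by (intro that[of N]) (auto simp: negligible_iff_null_sets)
qed

text \<open>The exceptional set is translated along; this serves coefficients evaluated at a delayed
  time.\<close>

lemma AE_lebesgue_shift_negligible:
  assumes "AE t in lebesgue. P (t::real)"
  obtains N where "negligible N" "\<And>t. t \<notin> N \<Longrightarrow> P (t + d)"
proof -
  obtain N where N: "negligible N" "\<And>t. t \<notin> N \<Longrightarrow> P t"
    using AE_lebesgue_negligible[OF assms] by blast
  have "negligible ((+) (- d) ` N)" using N(1) by (rule negligible_translation)
  moreover have "P (t + d)" if "t \<notin> (+) (- d) ` N" for t
    using that by (intro N(2)) (force simp: image_iff)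
  ultimately show ?thesis by (rule that)
qed

section \<open>The delayed Riccati equation\<close>

text \<open>Additivity of the integral turns an equation started at \<open>s\<close> into one
  started at \<open>T\<close>, where the Riccati equation has its data.\<close>

lemma ode_solution_terminal_iff:
  assumes "s \<le> T"
  shows "ode_solution s T X F \<longleftrightarrow>
    F absolutely_integrable_on {s..T} \<and> (\<forall>t\<in>{s..T}. X t = X T + integral {t..T} (\<lambda>r. - F r))"
proof (cases "F absolutely_integrable_on {s..T}")
  case True
  then have int: "F integrable_on {s..T}" by (rule set_lebesgue_integral_eq_integral)
  have comb: "integral {s..t} F + integral {t..T} F = integral {s..T} F" if "t \<in> {s..T}" for t
    using that int by (intro Henstock_Kurzweil_Integration.integral_combine) auto
  have "(\<forall>t\<in>{s..T}. X t = X s + integral {s..t} F) \<longleftrightarrow> (\<forall>t\<in>{s..T}. X t = X T - integral {t..T} F)"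
  proof (intro iffI ballI)
    fix t assume X: "\<forall>t\<in>{s..T}. X t = X s + integral {s..t} F" and t: "t \<in> {s..T}"
    have "X t = X s + integral {s..t} F" using X t by (rule bspec)
    moreover have "X T = X s + integral {s..T} F" by (rule bspec[OF X]) (use assms in auto)
    ultimately show "X t = X T - integral {t..T} F"
      unfolding comb[OF t, symmetric] by (simp only: add.assoc[symmetric] add_diff_cancel_right')
  next
    fix t assume X: "\<forall>t\<in>{s..T}. X t = X T - integral {t..T} F" and t: "t \<in> {s..T}"
    have "X t = X T - integral {t..T} F" using X t by (rule bspec)
    moreover have "X s = X T - integral {s..T} F" by (rule bspec[OF X]) (use assms in auto)
    ultimately show "X t = X s + integral {s..t} F"
      unfolding comb[OF t, symmetric] by (metis add_diff_cancel_left' diff_add_cancel diff_diff_add add.commute)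
  qed
  then show ?thesis using True by (simp add: ode_solution_def)
qed (simp add: ode_solution_def)

text \<open>
  The matrix \<open>a\<close> stands for \<open>A + I/2\<close>, which absorbs the term \<open>B \<Sigma> B\<^sup>T = \<Sigma>\<close>; \<open>\<rho>\<close> is the a priori bound
  of the norm of a solution, and the condition on \<open>\<delta>\<close> covers the linear, the comparison and the
  contraction arguments at once.
\<close>

locale delayed_riccati =
  fixes s T \<delta> k \<rho> :: real and a b q h :: "real \<Rightarrow> real^'n^'n" and M :: "real^'n^'n"
  assumes sT: "s \<le> T" and \<delta>: "0 < \<delta>" and k: "1 \<le> k"
    and coeffs: "bounded_measurable k {s..T} a" "bounded_measurable k {s..T} b"
      "bounded_measurable k {s..T} q" "bounded_measurable k {s..T} h"
    and q_psd: "\<And>t. t \<in> {s..T} \<Longrightarrow> psd (q t)"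
    and h_psd: "\<And>t. t \<in> {s..T} \<Longrightarrow> psd (h t)"
    and M_psd: "psd M" and M_bound: "norm M \<le> k"
    and \<rho>: "CARD('n) * CARD('n) * (k * exp ((2 * k + 3 * k\<^sup>2 + 1) * (T - s))) \<le> \<rho>"
    and small: "(4 * k + 8 * k * \<rho> + 6 * k\<^sup>2 + 1) * \<delta> \<le> 1"
begin

text \<open>The unknown lives on \<open>{s..T}\<close>; the identity history is inserted whenever a
  delayed argument falls before \<open>s\<close>.\<close>

definition ext :: "(real \<Rightarrow> real^'n^'n) \<Rightarrow> real \<Rightarrow> real^'n^'n" where
  "ext X t = (if t < s then mat 1 else X t)"

text \<open>The sign is that of minus the derivative, so that a solution satisfies
  \<open>Y t = M + integral {t..T} (rhs Y)\<close>.\<close>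

definition rhs :: "(real \<Rightarrow> real^'n^'n) \<Rightarrow> real \<Rightarrow> real^'n^'n" where
  "rhs X t = X t ** transpose (a t) + a t ** X t - 2 *\<^sub>R (X t ** q t ** X t)
    + b t ** ext X (t - \<delta>) ** transpose (b t) + h t"

definition cut :: "real^'n^'n \<Rightarrow> real^'n^'n" where
  "cut Y = closest_point (cball 0 \<rho>) Y"

text \<open>Only the quadratic term is cut off; the others are affine with bounded coefficients and
  hence already globally Lipschitz.\<close>

definition trunc_rhs :: "(real \<Rightarrow> real^'n^'n) \<Rightarrow> real \<Rightarrow> real^'n^'n" where
  "trunc_rhs X t = X t ** transpose (a t) + a t ** X t - 2 *\<^sub>R (cut (X t) ** q t ** cut (X t))
    + b t ** ext X (t - \<delta>) ** transpose (b t) + h t"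

text \<open>Twice the Lipschitz constant \<open>2 * k + 4 * k * \<rho> + 3 * k\<^sup>2\<close> of
  \<open>trunc_rhs\<close> in the weighted norm, plus one. It also dominates the rates that the
  positivity and comparison arguments require.\<close>

abbreviation \<mu> where "\<mu> \<equiv> 4 * k + 8 * k * \<rho> + 6 * k\<^sup>2 + 1"

lemma \<rho>_pos: "0 < \<rho>"
proof -
  have "0 < CARD('n) * CARD('n) * (k * exp ((2 * k + 3 * k\<^sup>2 + 1) * (T - s)))"
    using k by simp
  with \<rho> show ?thesis by linarith
qed

lemma \<mu>_ge: "2 * (k + k * \<rho>) + 3 * k\<^sup>2 + 1 \<le> \<mu>" "2 * k + 3 * k\<^sup>2 + 1 \<le> \<mu>" "0 < \<mu>"
  using \<rho>_pos k by (auto intro!: add_pos_nonneg simp: algebra_simps)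

lemma cut_scaling: "\<exists>c. 0 \<le> c \<and> c \<le> 1 \<and> cut Y = c *\<^sub>R Y"
  using \<rho>_pos closest_point_cball_0[of \<rho> Y]
  by (intro exI[of _ "if norm Y \<le> \<rho> then 1 else \<rho> / norm Y"]) (simp add: cut_def divide_le_eq)

lemma cut_id: "norm Y \<le> \<rho> \<Longrightarrow> cut Y = Y"
  unfolding cut_def by (rule closest_point_self) simp

lemma cut_transpose: "cut (transpose Y) = transpose (cut Y)"
  using \<rho>_pos by (simp add: cut_def closest_point_cball_0 transpose_scalar)

lemma norm_cut: "norm (cut Y) \<le> \<rho>"
  using closest_point_in_set[of "cball 0 \<rho>" Y] \<rho>_pos by (simp add: cut_def)

lemma cut_lipschitz: "norm (cut Y - cut Z) \<le> norm (Y - Z)"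
  using closest_point_lipschitz[of "cball 0 \<rho>" Y Z] \<rho>_pos by (simp add: cut_def dist_norm)

lemma bounded_meas_coeffs: "bounded_meas {s..T} a" "bounded_meas {s..T} b"
  "bounded_meas {s..T} q" "bounded_meas {s..T} h"
  using coeffs by (auto intro: bounded_measurable_imp_bounded_meas)

lemma bound:
  assumes "t \<in> {s..T}"
  shows "norm (a t) \<le> k" "norm (b t) \<le> k" "norm (q t) \<le> k" "norm (h t) \<le> k"
  using coeffs assms unfolding bounded_measurable_def by auto

lemma continuous_on_cut: "continuous_on S cut"
proof -
  have "dist (cut x) (cut y) \<le> 1 * dist x y" for x y
    using cut_lipschitz by (simp add: dist_norm)
  then show ?thesis
    by (intro lipschitz_on_continuous_on[of 1] lipschitz_onI) auto
qed

lemma trunc_rhs_abs_integrable: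
  assumes X: "continuous_on {s..T} X"
  shows "trunc_rhs X absolutely_integrable_on {s..T}"
proof -
  have "continuous_on {s..T} (\<lambda>t. cut (X t))"
    by (rule continuous_on_compose2[OF continuous_on_cut[of UNIV] X]) auto
  then show ?thesis
    unfolding trunc_rhs_def ext_def
    by (intro bounded_meas_abs_integrable bounded_meas_intros bounded_meas_coeffs
        bounded_meas_continuous bounded_meas_delayed X sT) (use \<delta> in auto)
qed

lemma trunc_rhs_integrable: "continuous_on {s..T} X \<Longrightarrow> trunc_rhs X integrable_on {s..T}"
  using trunc_rhs_abs_integrable set_lebesgue_integral_eq_integral(1) by blast

lemma trunc_rhs_lipschitz:
  assumes c: "0 \<le> c" and le: "\<And>r. r \<in> {s..T} \<Longrightarrow> norm (Y r - Z r) \<le> c * exp (\<mu> * (T - r))"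
    and t: "t \<in> {s..T}"
  shows "norm (trunc_rhs Y t - trunc_rhs Z t) \<le> \<mu> / 2 * c * exp (\<mu> * (T - t))"
proof -
  define d where "d = c * exp (\<mu> * (T - t))"
  have d0: "0 \<le> d" using c by (simp add: d_def)
  have d: "norm (Y t - Z t) \<le> d" using le[OF t] by (simp add: d_def)
  have cd: "norm (cut (Y t) - cut (Z t)) \<le> d" using d cut_lipschitz order_trans by blast
  have k0: "0 \<le> k" using k by simp
  have r0: "0 \<le> \<rho>" using \<rho>_pos by simp
  \<comment> \<open>Before \<open>s\<close> the two histories coincide and cancel; afterwards the
    weight at the delayed time is larger by at most the factor \<open>exp 1 \<le> 3\<close>.\<close>
  have del: "norm (ext Y (t - \<delta>) - ext Z (t - \<delta>)) \<le> 3 * d"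
  proof (cases "t - \<delta> < s")
    case True then show ?thesis using d0 by (simp add: ext_def)
  next
    case False
    then have "norm (Y (t - \<delta>) - Z (t - \<delta>)) \<le> c * exp (\<mu> * (T - (t - \<delta>)))"
      using t \<delta> by (intro le) auto
    also have "exp (\<mu> * (T - (t - \<delta>))) = exp (\<mu> * (T - t)) * exp (\<mu> * \<delta>)"
      by (simp add: algebra_simps flip: exp_add)
    also have "c * (exp (\<mu> * (T - t)) * exp (\<mu> * \<delta>)) \<le> c * (exp (\<mu> * (T - t)) * 3)"
    proof (intro mult_left_mono c)
      have "exp (\<mu> * \<delta>) \<le> exp 1" using small by simp
      then show "exp (\<mu> * \<delta>) \<le> 3" using exp_le by linarith
    qed simp
    finally show ?thesis using False by (simp add: ext_def d_def mult_ac)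
  qed
  let ?P = "(Y t - Z t) ** transpose (a t)" and ?Q = "a t ** (Y t - Z t)"
  \<comment> \<open>The difference of the quadratic terms telescopes, and in each piece the
    remaining cut-off factor is bounded by \<open>\<rho>\<close>.\<close>
  let ?R1 = "(cut (Y t) - cut (Z t)) ** q t ** cut (Y t)"
  let ?R2 = "cut (Z t) ** q t ** (cut (Y t) - cut (Z t))"
  let ?S = "b t ** (ext Y (t - \<delta>) - ext Z (t - \<delta>)) ** transpose (b t)"
  have eq: "trunc_rhs Y t - trunc_rhs Z t = ?P + ?Q - 2 *\<^sub>R (?R1 + ?R2) + ?S"
    by (simp add: trunc_rhs_def matrix_diff_distrib scaleR_diff_right scaleR_add_right)
  have tri: "norm (u + v - 2 *\<^sub>R z + y) \<le> norm u + norm v + 2 * norm z + norm y"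
    for u v y z :: "real^'n^'n"
  proof -
    have "norm (u + v - 2 *\<^sub>R z + y) \<le> norm (u + v) + norm (2 *\<^sub>R z) + norm y"
      using norm_triangle_ineq[of "u + v - 2 *\<^sub>R z" y]
        norm_triangle_ineq4[of "u + v" "2 *\<^sub>R z"] by linarith
    then show ?thesis using norm_triangle_ineq[of u v] by simp
  qed
  have P: "norm ?P \<le> d * k" using d bound(1)[OF t] d0 by (intro norm_mult_le) auto
  have Q: "norm ?Q \<le> k * d" using d bound(1)[OF t] k0 by (intro norm_mult_le) auto
  have R1: "norm ?R1 \<le> d * k * \<rho>"
    using cd bound(3)[OF t] d0 k0 norm_cut by (intro norm_mult_le) auto
  have R2: "norm ?R2 \<le> \<rho> * k * d"
    using cd bound(3)[OF t] r0 k0 norm_cut by (intro norm_mult_le) auto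
  have S: "norm ?S \<le> k * (3 * d) * k"
    using del bound(2)[OF t] d0 k0 by (intro norm_mult_le) auto
  have "norm (trunc_rhs Y t - trunc_rhs Z t)
      \<le> d * k + k * d + 2 * (d * k * \<rho> + \<rho> * k * d) + k * (3 * d) * k"
    unfolding eq using P Q R1 R2 S by (intro order_trans[OF tri]) (intro add_mono mult_left_mono norm_triangle_le, auto)
  also have "\<dots> \<le> \<mu> / 2 * d"
    using d0 by (simp add: algebra_simps power2_eq_square)
  finally show ?thesis by (simp add: d_def)
qed

lemma trunc_solution_exists:
  "\<exists>Y. continuous_on {s..T} Y \<and> (\<forall>t\<in>{s..T}. Y t = M + integral {t..T} (trunc_rhs Y))"
  by (rule terminal_integral_equation_exists[OF sT \<mu>_ge(3)])
    (rule trunc_rhs_integrable, assumption, rule trunc_rhs_lipschitz, assumption+)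

lemma trunc_solution_unique:
  assumes "continuous_on {s..T} Y" "\<And>t. t \<in> {s..T} \<Longrightarrow> Y t = M + integral {t..T} (trunc_rhs Y)"
    and "continuous_on {s..T} Z" "\<And>t. t \<in> {s..T} \<Longrightarrow> Z t = M + integral {t..T} (trunc_rhs Z)"
    and "t \<in> {s..T}"
  shows "Y t = Z t"
  by (rule terminal_integral_equation_unique[OF \<mu>_ge(3) _ _ assms])
    (rule trunc_rhs_integrable, assumption, rule trunc_rhs_lipschitz, assumption+)

section \<open>Comparison with exponential multiples of the identity\<close>

lemma norm_matrix_le_\<rho>:
  fixes Y :: "real^'n^'n"
  assumes Y: "psd Y" and le: "\<And>x. x \<bullet> (Y *v x) \<le> k * exp ((2 * k + 3 * k\<^sup>2 + 1) * (T - t)) * (x \<bullet> x)"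
    and t: "t \<in> {s..T}"
  shows "norm Y \<le> \<rho>"
proof -
  have "norm Y \<le> CARD('n) * CARD('n) * (k * exp ((2 * k + 3 * k\<^sup>2 + 1) * (T - t)))"
    using psd_norm_le[OF Y le] by simp
  also have "\<dots> \<le> CARD('n) * CARD('n) * (k * exp ((2 * k + 3 * k\<^sup>2 + 1) * (T - s)))"
    using t k by (intro mult_left_mono) (auto intro!: mult_left_mono)
  finally show ?thesis using \<rho> by simp
qed

text \<open>The barrier minus \<open>Y\<close> solves a delayed linear equation with nonnegative
  source \<open>G\<close>: the rate \<open>\<nu>\<close> pays \<open>2 * k\<close> for
  \<open>a\<close>, \<open>3 * k\<^sup>2\<close> for the delayed term and \<open>1\<close> for
  \<open>h\<close>, while \<open>p\<close> has a favourable sign. Keeping \<open>p\<close> abstract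
  covers both the cut-off and the original quadratic term.\<close>

lemma upper_bound:
  assumes cont: "continuous_on {s..T} Y"
    and sym: "\<And>t. t \<in> {s..T} \<Longrightarrow> transpose (Y t) = Y t"
    and sol: "\<And>t. t \<in> {s..T} \<Longrightarrow> (R has_integral Y t - M) {t..T}" and YT: "Y T = M"
    and R: "\<And>t. t \<in> {s..T} \<Longrightarrow> R t = Y t ** transpose (a t) + a t ** Y t - p t
      + b t ** ext Y (t - \<delta>) ** transpose (b t) + h t"
    and p: "\<And>t x. t \<in> {s..T} \<Longrightarrow> 0 \<le> x \<bullet> (p t *v x)"
    and t: "t \<in> {s..T}"
  shows "x \<bullet> (Y t *v x) \<le> k * exp ((2 * k + 3 * k\<^sup>2 + 1) * (T - t)) * (x \<bullet> x)"
proof -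
  define \<nu> where "\<nu> = 2 * k + 3 * k\<^sup>2 + 1"
  have \<nu>0: "0 \<le> \<nu>" using k by (simp add: \<nu>_def)
  have \<nu>\<delta>: "\<nu> * \<delta> \<le> 1"
    using mult_right_mono[OF \<mu>_ge(2), of \<delta>] \<delta> small unfolding \<nu>_def by linarith
  \<comment> \<open>The factor \<open>k\<close> makes the barrier dominate \<open>M\<close> at
    \<open>T\<close>, the identity before \<open>s\<close> and the bound on
    \<open>h\<close>.\<close>
  define E where "E t = k * exp (\<nu> * (T - t))" for t
  have Ek: "k \<le> E t" if "t \<le> T" for t
    using that k \<nu>0 by (simp add: E_def)
  have Edelay: "E (r - \<delta>) \<le> 3 * E r" for r
  proof -
    have "E (r - \<delta>) = E r * exp (\<nu> * \<delta>)"
      by (simp add: E_def algebra_simps flip: exp_add)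
    also have "exp (\<nu> * \<delta>) \<le> exp 1" using \<nu>\<delta> by simp
    also have "exp (1::real) \<le> 3" by (rule exp_le)
    finally show ?thesis using k by (simp add: E_def mult.commute)
  qed
  define D where "D r = E r *\<^sub>R mat 1 - ext Y r" for r
  define G where "G r = (\<nu> * E r) *\<^sub>R mat 1 - E r *\<^sub>R (transpose (a r) + a r)
    - E (r - \<delta>) *\<^sub>R (b r ** transpose (b r)) + p r - h r" for r
  have D: "D r = E r *\<^sub>R mat 1 - Y r" if "r \<in> {s..T}" for r
    using that by (simp add: D_def ext_def)
  have "psd (D t)"
  proof (rule delayed_positivity[where e=a and b=b and G=G and F="\<lambda>r. (\<nu> * E r) *\<^sub>R mat 1 - R r"])
    show "0 \<le> \<delta>" "0 \<le> k" using \<delta> k by auto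
    show "2 * k + 3 * k\<^sup>2 + 1 \<le> \<nu>" by (simp add: \<nu>_def)
    show "\<nu> * \<delta> \<le> 1" by (rule \<nu>\<delta>)
    have "continuous_on {s..T} (\<lambda>r. E r *\<^sub>R mat 1 - Y r)"
      unfolding E_def by (intro continuous_intros cont)
    then show "continuous_on {s..T} D" by (rule continuous_on_eq) (simp add: D)
    show "((\<lambda>r. (\<nu> * E r) *\<^sub>R mat 1 - R r) has_integral D r - D T) {r..T}" if r: "r \<in> {s..T}" for r
    proof -
      have "((\<lambda>r. \<nu> * E r) has_integral E r - k) {r..T}"
        unfolding E_def using has_integral_exp_weight[of r T \<nu> k] r by (simp add: mult_ac)
      then have "((\<lambda>r. (\<nu> * E r) *\<^sub>R mat 1) has_integral (E r - k) *\<^sub>R (mat 1 :: real^'n^'n)) {r..T}"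
        by (rule has_integral_scaleR_left)
      from has_integral_diff[OF this sol[OF r]] show ?thesis
        using r sT YT by (simp add: D E_def algebra_simps)
    qed
    show "(\<nu> * E r) *\<^sub>R mat 1 - R r = D r ** transpose (a r) + a r ** D r
        + b r ** D (r - \<delta>) ** transpose (b r) + G r" if r: "r \<in> {s..T}" for r
      by (simp add: R[OF r] G_def D_def[of "r - \<delta>"] D[OF r] matrix_diff_distrib matrix_scaleR_mult
          scaleR_add_right)
    show "norm (a r) \<le> k" "norm (b r) \<le> k" if "r \<in> {s..T}" for r using bound that by auto
    show "0 \<le> x \<bullet> (G r *v x)" if r: "r \<in> {s..T}" for r x
    proof -
      have E0: "0 \<le> E r" "0 \<le> E (r - \<delta>)" using k by (auto simp: E_def)
      have A: "x \<bullet> (a r *v x) \<le> k * (x \<bullet> x)"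
        using abs_quadratic_form_le[of x "a r"] bound(1)[OF r]
          mult_right_mono[of "norm (a r)" k "x \<bullet> x"] by simp
      have H: "x \<bullet> (h r *v x) \<le> k * (x \<bullet> x)"
        using abs_quadratic_form_le[of x "h r"] bound(4)[OF r]
          mult_right_mono[of "norm (h r)" k "x \<bullet> x"] by simp
      have H': "k * (x \<bullet> x) \<le> E r * (x \<bullet> x)"
        using Ek[of r] r by (intro mult_right_mono) auto
      have B: "x \<bullet> ((b r ** transpose (b r)) *v x) \<le> k\<^sup>2 * (x \<bullet> x)"
        using quadratic_form_gram_bounds(2)[of x "b r"] bound(2)[OF r]
          mult_right_mono[of "(norm (b r))\<^sup>2" "k\<^sup>2" "x \<bullet> x"] by (simp add: power_mono)
      have A': "E r * (x \<bullet> (a r *v x)) \<le> E r * (k * (x \<bullet> x))"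
        using A E0 by (intro mult_left_mono) auto
      have B': "E (r - \<delta>) * (x \<bullet> ((b r ** transpose (b r)) *v x)) \<le> (3 * E r) * (k\<^sup>2 * (x \<bullet> x))"
        using B E0 quadratic_form_gram_bounds(1)[of x "b r"] Edelay[of r] by (intro mult_mono) auto
      have "x \<bullet> (G r *v x) = \<nu> * E r * (x \<bullet> x) - 2 * (E r * (x \<bullet> (a r *v x)))
          - E (r - \<delta>) * (x \<bullet> ((b r ** transpose (b r)) *v x)) + x \<bullet> (p r *v x) - x \<bullet> (h r *v x)"
        by (simp add: G_def quadratic_form_simps quadratic_form_transpose
            del: transpose_matrix_vector)
      moreover have "\<nu> * E r * (x \<bullet> x) = 2 * (E r * (k * (x \<bullet> x))) + (3 * E r) * (k\<^sup>2 * (x \<bullet> x)) + E r * (x \<bullet> x)"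
        by (simp add: \<nu>_def algebra_simps)
      ultimately show ?thesis using A' B' H H' p[OF r, of x] by linarith
    qed
    show "transpose (D r) = D r" if "r \<in> {s..T}" for r
      using sym[OF that] by (simp add: D[OF that] transpose_diff transpose_scalar)
    show "0 \<le> x \<bullet> (D r *v x)" if "r \<in> {s-\<delta>..<s}" for r x
    proof -
      have "1 \<le> E r" using Ek[of r] that sT k by simp
      then have "1 * (x \<bullet> x) \<le> E r * (x \<bullet> x)" by (intro mult_right_mono) auto
      then show ?thesis using that by (simp add: D_def ext_def quadratic_form_simps)
    qed
    show "0 \<le> x \<bullet> (D T *v x)" for x
    proof -
      have "x \<bullet> (M *v x) \<le> k * (x \<bullet> x)"
        using abs_quadratic_form_le[of x M] M_bound mult_right_mono[of "norm M" k "x \<bullet> x"] by simp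
      then show ?thesis using sT YT by (simp add: D E_def quadratic_form_simps)
    qed
    show "t \<in> {s..T}" by (rule t)
  qed
  then have "0 \<le> x \<bullet> (D t *v x)" by (simp add: psd_def)
  then show ?thesis using t by (simp add: D E_def \<nu>_def quadratic_form_simps)
qed

text \<open>With \<open>e = a - Y q\<close> the quadratic term is shared by the two sides and the
  equation is linear along \<open>Y\<close>. Subtracting a barrier with rate \<open>2 * c\<close>
  leaves a nonnegative source, since \<open>c\<close> bounds \<open>e\<close>.\<close>

lemma riccati_spd:
  assumes cont: "continuous_on {s..T} Y"
    and psd: "\<And>t. t \<in> {s..T} \<Longrightarrow> psd (Y t)" and Y\<rho>: "\<And>t. t \<in> {s..T} \<Longrightarrow> norm (Y t) \<le> \<rho>"
    and sol: "\<And>t. t \<in> {s..T} \<Longrightarrow> (rhs Y has_integral Y t - M) {t..T}" and YT: "Y T = M"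
    and M: "spd M" and t: "t \<in> {s..T}"
  shows "spd (Y t)"
proof -
  define c where "c = k + \<rho> * k"
  have c0: "0 \<le> c" using k \<rho>_pos by (simp add: c_def)
  \<comment> \<open>The negative rate makes the barrier shrink backwards in time while it stays
    positive.\<close>
  define \<nu> where "\<nu> = - (2 * c)"
  have "\<exists>z\<in>sphere 0 1. \<forall>x\<in>sphere 0 1. z \<bullet> (M *v z) \<le> x \<bullet> (M *v x)"
    by (intro continuous_attains_inf continuous_intros
        bounded_bilinear.continuous_on[OF bounded_bilinear_matrix_vector_mult]) auto
  then obtain z where z: "norm z = 1" and zmin: "\<And>x. norm x = 1 \<Longrightarrow> z \<bullet> (M *v z) \<le> x \<bullet> (M *v x)"
    by auto
  \<comment> \<open>The minimum of the form on the unit sphere is the smallest eigenvalue of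
    \<open>M\<close>; the bound \<open>1\<close> keeps the barrier below the identity
    history.\<close>
  define \<epsilon> where "\<epsilon> = min 1 (z \<bullet> (M *v z))"
  have "z \<noteq> 0" using z by auto
  then have \<epsilon>0: "0 < \<epsilon>" using M by (simp add: \<epsilon>_def spd_def)
  have \<epsilon>1: "\<epsilon> \<le> 1" by (simp add: \<epsilon>_def)
  have \<epsilon>M: "\<epsilon> * (x \<bullet> x) \<le> x \<bullet> (M *v x)" for x
  proof (cases "x = 0")
    case False
    define y where "y = x /\<^sub>R norm x"
    have "\<epsilon> \<le> y \<bullet> (M *v y)" using zmin[of y] False by (simp add: \<epsilon>_def y_def)
    moreover have "y \<bullet> (M *v y) = (x \<bullet> (M *v x)) / (x \<bullet> x)"
      by (simp add: y_def matrix_vector_mult_scaleR dot_square_norm power2_eq_square divide_inverse)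
    ultimately show ?thesis using False by (simp add: field_simps)
  qed simp
  define E where "E r = \<epsilon> * exp (\<nu> * (T - r))" for r
  have E0: "0 < E r" for r using \<epsilon>0 by (simp add: E_def)
  define e where "e r = a r - Y r ** q r" for r
  define D where "D r = ext Y r - E r *\<^sub>R mat 1" for r
  define G where "G r = (2 * c * E r) *\<^sub>R mat 1 + E r *\<^sub>R (transpose (e r) + e r)
    + E (r - \<delta>) *\<^sub>R (b r ** transpose (b r)) + h r" for r
  have D: "D r = Y r - E r *\<^sub>R mat 1" if "r \<in> {s..T}" for r
    using that by (simp add: D_def ext_def)
  have e: "norm (e r) \<le> c" if r: "r \<in> {s..T}" for r
  proof -
    have "norm (Y r ** q r) \<le> \<rho> * k"
      using Y\<rho>[OF r] bound(3)[OF r] \<rho>_pos by (intro norm_mult_le) auto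
    then show ?thesis
      using norm_triangle_ineq4[of "a r" "Y r ** q r"] bound(1)[OF r] by (simp add: e_def c_def)
  qed
  have et: "transpose (e r) = transpose (a r) - q r ** Y r" if r: "r \<in> {s..T}" for r
    using psd[OF r] q_psd[OF r] by (simp add: e_def transpose_diff matrix_transpose_mul psd_def)
  have "psd (D t)"
  proof (rule delayed_positivity[where e=e and b=b and G=G and F="\<lambda>r. rhs Y r - (\<nu> * E r) *\<^sub>R mat 1"])
    show "0 \<le> \<delta>" "0 \<le> c" using \<delta> c0 by auto
    show "2 * c + 3 * k\<^sup>2 + 1 \<le> \<mu>" using \<mu>_ge(1) by (simp add: c_def mult.commute)
    show "\<mu> * \<delta> \<le> 1" by (rule small)
    have "continuous_on {s..T} (\<lambda>r. Y r - E r *\<^sub>R mat 1)"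
      unfolding E_def by (intro continuous_intros cont)
    then show "continuous_on {s..T} D" by (rule continuous_on_eq) (simp add: D)
    show "((\<lambda>r. rhs Y r - (\<nu> * E r) *\<^sub>R mat 1) has_integral D r - D T) {r..T}" if r: "r \<in> {s..T}" for r
    proof -
      have "((\<lambda>r. \<nu> * E r) has_integral E r - \<epsilon>) {r..T}"
        unfolding E_def using has_integral_exp_weight[of r T \<nu> \<epsilon>] r by (simp add: mult_ac)
      then have "((\<lambda>r. (\<nu> * E r) *\<^sub>R mat 1) has_integral (E r - \<epsilon>) *\<^sub>R (mat 1 :: real^'n^'n)) {r..T}"
        by (rule has_integral_scaleR_left)
      from has_integral_diff[OF sol[OF r] this] show ?thesis
        using r sT YT by (simp add: D E_def algebra_simps)
    qed
    show "rhs Y r - (\<nu> * E r) *\<^sub>R mat 1 = D r ** transpose (e r) + e r ** D r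
        + b r ** D (r - \<delta>) ** transpose (b r) + G r" if r: "r \<in> {s..T}" for r
    proof -
      have "D r ** transpose (e r) + e r ** D r
        = Y r ** transpose (e r) + e r ** Y r - E r *\<^sub>R (transpose (e r) + e r)"
        by (simp add: D[OF r] matrix_diff_distrib matrix_scaleR_mult scaleR_add_right)
      moreover have "Y r ** transpose (e r) + e r ** Y r
        = Y r ** transpose (a r) + a r ** Y r - 2 *\<^sub>R (Y r ** q r ** Y r)"
        by (simp add: et[OF r]) (simp add: e_def matrix_diff_distrib matrix_mul_assoc scaleR_2)
      ultimately show ?thesis
        by (simp add: rhs_def G_def D_def[of "r - \<delta>"] matrix_diff_distrib matrix_scaleR_mult \<nu>_def)
    qed
    show "norm (e r) \<le> c" "norm (b r) \<le> k" if "r \<in> {s..T}" for r using bound e that by auto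
    show "0 \<le> x \<bullet> (G r *v x)" if r: "r \<in> {s..T}" for r x
    proof -
      have "- (c * (x \<bullet> x)) \<le> x \<bullet> (e r *v x)"
        using abs_quadratic_form_le[of x "e r"] e[OF r]
          mult_right_mono[of "norm (e r)" c "x \<bullet> x"] by simp
      then have "E r * (- (c * (x \<bullet> x))) \<le> E r * (x \<bullet> (e r *v x))"
        using E0[of r] by (intro mult_left_mono) auto
      moreover have "0 \<le> E (r - \<delta>) * (x \<bullet> ((b r ** transpose (b r)) *v x))"
        using quadratic_form_gram_bounds(1) E0 by (intro mult_nonneg_nonneg) (auto intro: less_imp_le)
      moreover have "0 \<le> x \<bullet> (h r *v x)" using h_psd[OF r] by (simp add: psd_def)
      moreover have "x \<bullet> (G r *v x) = 2 * (c * E r * (x \<bullet> x)) + 2 * (E r * (x \<bullet> (e r *v x)))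
          + E (r - \<delta>) * (x \<bullet> ((b r ** transpose (b r)) *v x)) + x \<bullet> (h r *v x)"
        by (simp add: G_def quadratic_form_simps quadratic_form_transpose
            del: transpose_matrix_vector)
      ultimately show ?thesis by (simp add: mult_ac)
    qed
    show "transpose (D r) = D r" if "r \<in> {s..T}" for r
      using psd[OF that] by (simp add: D[OF that] transpose_diff transpose_scalar psd_def)
    show "0 \<le> x \<bullet> (D r *v x)" if "r \<in> {s-\<delta>..<s}" for r x
    proof -
      have "\<nu> * (T - r) \<le> 0" using that sT c0 by (simp add: \<nu>_def)
      then have "E r \<le> 1 * 1" unfolding E_def using \<epsilon>0 \<epsilon>1 by (intro mult_mono) auto
      then have "E r * (x \<bullet> x) \<le> 1 * (x \<bullet> x)" by (intro mult_right_mono) auto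
      then show ?thesis using that by (simp add: D_def ext_def quadratic_form_simps)
    qed
    show "0 \<le> x \<bullet> (D T *v x)" for x
      using \<epsilon>M[of x] sT YT by (simp add: D E_def quadratic_form_simps)
    show "t \<in> {s..T}" by (rule t)
  qed
  then have "E t * (x \<bullet> x) \<le> x \<bullet> (Y t *v x)" for x
    using t by (simp add: psd_def D quadratic_form_simps)
  moreover have "0 < E t * (x \<bullet> x)" if "x \<noteq> 0" for x :: "real^'n" using E0[of t] that by simp
  ultimately show ?thesis
    using psd[OF t] unfolding spd_def psd_def by (meson less_le_trans)
qed

section \<open>Symmetry, positivity and bounds for the truncated solution\<close>

lemma terminal_has_integral:
  assumes R: "R integrable_on {s..T}" and Y: "\<And>t. t \<in> {s..T} \<Longrightarrow> Y t = M + integral {t..T} R"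
    and t: "t \<in> {s..T}"
  shows "(R has_integral Y t - M) {t..T}"
  using integrable_integral[OF integrable_on_subinterval[OF R, of t T]] t by (simp add: Y[OF t])

text \<open>The transpose solves the same truncated equation, as \<open>cut\<close> commutes with
  transposition, so uniqueness applies. Symmetry comes first because
  \<open>delayed_positivity\<close> presupposes it.\<close>

lemma trunc_solution_symmetric:
  assumes cont: "continuous_on {s..T} Y" and sol: "\<And>t. t \<in> {s..T} \<Longrightarrow> Y t = M + integral {t..T} (trunc_rhs Y)"
    and t: "t \<in> {s..T}"
  shows "transpose (Y t) = Y t"
proof (rule trunc_solution_unique[OF _ _ cont sol t])
  show "continuous_on {s..T} (\<lambda>t. transpose (Y t))"
    by (intro bounded_linear.continuous_on[OF bounded_linear_transpose] cont)
  fix r assume r: "r \<in> {s..T}"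
  have rhs: "trunc_rhs (\<lambda>t. transpose (Y t)) q' = transpose (trunc_rhs Y q')" if "q' \<in> {s..T}" for q'
    using q_psd[OF that] h_psd[OF that]
    by (simp add: trunc_rhs_def transpose_add transpose_diff transpose_scalar matrix_transpose_mul
        cut_transpose ext_def psd_def matrix_mul_assoc)
  have int: "trunc_rhs Y integrable_on {r..T}"
    using integrable_on_subinterval[OF trunc_rhs_integrable[OF cont], of r T] r by simp
  have "transpose (Y r) = M + transpose (integral {r..T} (trunc_rhs Y))"
    using M_psd by (simp add: sol[OF r] transpose_add psd_def)
  also have "transpose (integral {r..T} (trunc_rhs Y)) = integral {r..T} (\<lambda>t. transpose (trunc_rhs Y t))"
    using integral_linear[OF int bounded_linear_transpose] by (simp add: o_def)
  also have "\<dots> = integral {r..T} (trunc_rhs (\<lambda>t. transpose (Y t)))"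
    using r by (intro integral_cong) (simp add: rhs)
  finally show "transpose (Y r) = M + integral {r..T} (trunc_rhs (\<lambda>t. transpose (Y t)))" .
qed

text \<open>Since \<open>cut (Y r)\<close> is a multiple of \<open>Y r\<close>, the equation is
  linear along its solution, with source \<open>h\<close>. \<open>delayed_positivity\<close> asks
  for a pointwise bound on \<open>e\<close>, so the scalars \<open>c r\<close> can be chosen
  separately at each time.\<close>

lemma trunc_solution_psd:
  assumes cont: "continuous_on {s..T} Y" and sol: "\<And>t. t \<in> {s..T} \<Longrightarrow> Y t = M + integral {t..T} (trunc_rhs Y)"
    and t: "t \<in> {s..T}"
  shows "psd (Y t)"
proof -
  have sym: "transpose (Y r) = Y r" if "r \<in> {s..T}" for r
    using cont sol that by (rule trunc_solution_symmetric)
  have YT: "Y T = M" using sol[of T] sT by simp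
  have "\<forall>r. \<exists>c. 0 \<le> c \<and> c \<le> 1 \<and> cut (Y r) = c *\<^sub>R Y r" using cut_scaling by blast
  from choice[OF this] obtain c
    where c: "\<And>r. 0 \<le> c r" "\<And>r. c r \<le> 1" "\<And>r. cut (Y r) = c r *\<^sub>R Y r"
    by blast
  \<comment> \<open>The cut-off term is \<open>c\<^sup>2 Y q Y\<close>, and \<open>c\<^sup>2 Y q = c (cut Y) q\<close> is bounded independently of \<open>Y\<close>.\<close>
  define e where "e r = a r - (c r)\<^sup>2 *\<^sub>R (Y r ** q r)" for r
  have "psd (ext Y t)"
  proof (rule delayed_positivity[where e=e and b=b and G=h and F="trunc_rhs Y"])
    show "0 \<le> \<delta>" "0 \<le> k + k * \<rho>" using \<delta> k \<rho>_pos by auto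
    show "2 * (k + k * \<rho>) + 3 * k\<^sup>2 + 1 \<le> \<mu>" by (rule \<mu>_ge)
    show "\<mu> * \<delta> \<le> 1" by (rule small)
    show "continuous_on {s..T} (ext Y)"
      using cont by (rule continuous_on_eq) (simp add: ext_def)
    show "(trunc_rhs Y has_integral ext Y r - ext Y T) {r..T}" if "r \<in> {s..T}" for r
      using terminal_has_integral[OF trunc_rhs_integrable[OF cont] sol that] that sT YT by (simp add: ext_def)
    show "norm (b r) \<le> k" if "r \<in> {s..T}" for r using bound that by auto
    show "norm (e r) \<le> k + k * \<rho>" if r: "r \<in> {s..T}" for r
    proof -
      have "(c r)\<^sup>2 *\<^sub>R (Y r ** q r) = c r *\<^sub>R (cut (Y r) ** q r)"
        by (simp add: c(3) matrix_scaleR_mult power2_eq_square)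
      also have "norm \<dots> \<le> 1 * (\<rho> * k)"
        unfolding norm_scaleR
        using c(1,2)[of r] norm_cut bound(3)[OF r] \<rho>_pos by (intro mult_mono norm_mult_le) auto
      finally show ?thesis
        using norm_triangle_ineq4[of "a r" "(c r)\<^sup>2 *\<^sub>R (Y r ** q r)"] bound(1)[OF r]
        by (simp add: e_def mult.commute)
    qed
    show "trunc_rhs Y r = ext Y r ** transpose (e r) + e r ** ext Y r
        + b r ** ext Y (r - \<delta>) ** transpose (b r) + h r" if r: "r \<in> {s..T}" for r
    proof -
      have et: "transpose (e r) = transpose (a r) - (c r)\<^sup>2 *\<^sub>R (q r ** Y r)"
        using sym[OF r] q_psd[OF r]
        by (simp add: e_def transpose_diff transpose_scalar matrix_transpose_mul psd_def)
      define u where "u = (c r)\<^sup>2 *\<^sub>R (Y r ** q r ** Y r)"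
      have u: "cut (Y r) ** q r ** cut (Y r) = u"
        by (simp add: u_def c(3) matrix_scaleR_mult power2_eq_square)
      have "Y r ** transpose (e r) = Y r ** transpose (a r) - u" "e r ** Y r = a r ** Y r - u"
        by (simp_all add: et u_def matrix_diff_distrib matrix_scaleR_mult matrix_mul_assoc)
          (simp add: e_def matrix_diff_distrib matrix_scaleR_mult matrix_mul_assoc)
      then show ?thesis
        using r by (simp add: ext_def trunc_rhs_def u scaleR_2)
    qed
    show "0 \<le> x \<bullet> (h r *v x)" if "r \<in> {s..T}" for r x using h_psd[OF that] by (simp add: psd_def)
    show "transpose (ext Y r) = ext Y r" if "r \<in> {s..T}" for r using sym[OF that] by (simp add: ext_def)
    show "0 \<le> x \<bullet> (ext Y r *v x)" if "r \<in> {s-\<delta>..<s}" for r x using that by (simp add: ext_def)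
    show "0 \<le> x \<bullet> (ext Y T *v x)" for x using sT YT M_psd by (simp add: ext_def psd_def)
    show "t \<in> {s..T}" by (rule t)
  qed
  then show ?thesis using t by (simp add: ext_def)
qed

lemma trunc_solution_le_\<rho>:
  assumes cont: "continuous_on {s..T} Y" and sol: "\<And>t. t \<in> {s..T} \<Longrightarrow> Y t = M + integral {t..T} (trunc_rhs Y)"
    and t: "t \<in> {s..T}"
  shows "norm (Y t) \<le> \<rho>"
proof (rule norm_matrix_le_\<rho>[OF trunc_solution_psd[OF cont sol t] _ t])
  fix x
  show "x \<bullet> (Y t *v x) \<le> k * exp ((2 * k + 3 * k\<^sup>2 + 1) * (T - t)) * (x \<bullet> x)"
  proof (rule upper_bound[OF cont trunc_solution_symmetric[OF cont sol]
        terminal_has_integral[OF trunc_rhs_integrable[OF cont] sol] _ _ _ t])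
    show "Y T = M" using sol[of T] sT by simp
    fix r assume r: "r \<in> {s..T}"
    show "trunc_rhs Y r = Y r ** transpose (a r) + a r ** Y r - 2 *\<^sub>R (cut (Y r) ** q r ** cut (Y r))
      + b r ** ext Y (r - \<delta>) ** transpose (b r) + h r" by (simp add: trunc_rhs_def)
    \<comment> \<open>A nonnegative multiple of a positive semidefinite matrix is again one, so the
      cut-off quadratic term keeps its favourable sign.\<close>
    obtain c where "0 \<le> c" "cut (Y r) = c *\<^sub>R Y r" using cut_scaling by blast
    then have "psd (cut (Y r))"
      using trunc_solution_psd[OF cont sol r]
      by (simp add: psd_def transpose_scalar flip: scaleR_matrix_vector_assoc)
    then show "0 \<le> x \<bullet> ((2 *\<^sub>R (cut (Y r) ** q r ** cut (Y r))) *v x)" for x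
      using q_psd[OF r] by (rule psd_quadratic)
  qed
qed

section \<open>Return from the truncated to the original equation\<close>

lemma rhs_eq_trunc_rhs: "norm (Y t) \<le> \<rho> \<Longrightarrow> rhs Y t = trunc_rhs Y t"
  by (simp add: rhs_def trunc_rhs_def cut_id)

lemma riccati_exists:
  obtains Y where "continuous_on {s..T} Y" "\<And>t. t \<in> {s..T} \<Longrightarrow> psd (Y t)"
    "rhs Y absolutely_integrable_on {s..T}" "\<And>t. t \<in> {s..T} \<Longrightarrow> Y t = M + integral {t..T} (rhs Y)"
proof -
  obtain Y where cont: "continuous_on {s..T} Y"
    and sol: "\<And>t. t \<in> {s..T} \<Longrightarrow> Y t = M + integral {t..T} (trunc_rhs Y)"
    using trunc_solution_exists by blast
  have eq: "rhs Y t = trunc_rhs Y t" if "t \<in> {s..T}" for t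
    using cont sol that by (intro rhs_eq_trunc_rhs trunc_solution_le_\<rho>)
  have "rhs Y absolutely_integrable_on {s..T}"
    using trunc_rhs_abs_integrable[OF cont]
    by (rule absolutely_integrable_spike[where S="{}"]) (auto simp: eq)
  moreover have "Y t = M + integral {t..T} (rhs Y)" if t: "t \<in> {s..T}" for t
  proof -
    have "integral {t..T} (rhs Y) = integral {t..T} (trunc_rhs Y)"
      using t by (intro integral_cong) (simp add: eq)
    then show ?thesis using sol[OF t] by simp
  qed
  ultimately show ?thesis
    using that cont trunc_solution_psd[OF cont sol] by blast
qed

text \<open>Positivity of \<open>Y\<close>, here a hypothesis, gives the quadratic term its sign in
  the upper comparison; the resulting bound is common to all such solutions.\<close>

lemma riccati_solution_le_\<rho>:
  assumes cont: "continuous_on {s..T} Y" and psd: "\<And>t. t \<in> {s..T} \<Longrightarrow> psd (Y t)"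
    and int: "rhs Y integrable_on {s..T}" and sol: "\<And>t. t \<in> {s..T} \<Longrightarrow> Y t = M + integral {t..T} (rhs Y)"
    and t: "t \<in> {s..T}"
  shows "norm (Y t) \<le> \<rho>"
proof (rule norm_matrix_le_\<rho>[OF psd[OF t] _ t])
  fix x
  show "x \<bullet> (Y t *v x) \<le> k * exp ((2 * k + 3 * k\<^sup>2 + 1) * (T - t)) * (x \<bullet> x)"
  proof (rule upper_bound[OF cont _ terminal_has_integral[OF int sol] _ _ _ t])
    show "Y T = M" using sol[of T] sT by simp
    fix r assume r: "r \<in> {s..T}"
    show "transpose (Y r) = Y r" using psd[OF r] by (simp add: psd_def)
    show "rhs Y r = Y r ** transpose (a r) + a r ** Y r - 2 *\<^sub>R (Y r ** q r ** Y r)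
      + b r ** ext Y (r - \<delta>) ** transpose (b r) + h r" by (simp add: rhs_def)
    show "0 \<le> x \<bullet> ((2 *\<^sub>R (Y r ** q r ** Y r)) *v x)" for x
      using psd[OF r] q_psd[OF r] by (rule psd_quadratic)
  qed
qed

text \<open>Both solutions stay in the ball on which \<open>cut\<close> is the identity, so both
  solve the truncated equation, whose solution is unique.\<close>

lemma riccati_unique:
  assumes Y: "continuous_on {s..T} Y" "\<And>t. t \<in> {s..T} \<Longrightarrow> psd (Y t)" "rhs Y integrable_on {s..T}"
      "\<And>t. t \<in> {s..T} \<Longrightarrow> Y t = M + integral {t..T} (rhs Y)"
    and Z: "continuous_on {s..T} Z" "\<And>t. t \<in> {s..T} \<Longrightarrow> psd (Z t)" "rhs Z integrable_on {s..T}"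
      "\<And>t. t \<in> {s..T} \<Longrightarrow> Z t = M + integral {t..T} (rhs Z)"
    and t: "t \<in> {s..T}"
  shows "Y t = Z t"
proof (rule trunc_solution_unique[OF Y(1) _ Z(1) _ t])
  fix r assume r: "r \<in> {s..T}"
  have "integral {r..T} (rhs Y) = integral {r..T} (trunc_rhs Y)"
    using r by (intro integral_cong rhs_eq_trunc_rhs riccati_solution_le_\<rho>[OF Y]) auto
  then show "Y r = M + integral {r..T} (trunc_rhs Y)" using Y(4)[OF r] by simp
  have "integral {r..T} (rhs Z) = integral {r..T} (trunc_rhs Z)"
    using r by (intro integral_cong rhs_eq_trunc_rhs riccati_solution_le_\<rho>[OF Z]) auto
  then show "Z r = M + integral {r..T} (trunc_rhs Z)" using Z(4)[OF r] by simp
qed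

end

section \<open>One delay threshold for all admissible data\<close>

theorem proposition4p2:
  fixes T K \<alpha> :: real
  assumes "0 < T" and "0 < \<alpha>"
  shows "\<exists>\<delta>0>0. \<forall>\<delta> s (p :: ('n::finite, 'd::finite) lq_coeffs) (M :: real^'n^'n).
    0 < \<delta> \<longrightarrow> \<delta> \<le> \<delta>0 \<longrightarrow> s \<in> {0..T} \<longrightarrow>
    admissible K \<alpha> s T \<delta> p \<longrightarrow>
    psd M \<longrightarrow> norm M \<le> K \<longrightarrow>
    (\<forall>t\<in>{s..T}. cB p t = mat 1) \<longrightarrow>
    (\<forall>X. iterative_scheme p \<delta> s T M X \<longrightarrow>
      (\<forall>i Y. advanced_solution p \<delta> s T (Ahat p \<delta> (X i)) Y \<longrightarrow> (\<forall>t\<in>{s..T}. pos_def (Y t)))) \<longrightarrow>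
    (\<exists>S. (riccati_solution p \<delta> s T M S \<and> continuous_on {s..T} S \<and> (\<forall>t\<in>{s..T}. psd (S t))) \<and>
      (\<forall>S'. riccati_solution p \<delta> s T M S' \<and> continuous_on {s..T} S' \<and> (\<forall>t\<in>{s..T}. psd (S' t)) \<longrightarrow>
        (\<forall>t\<in>{s..T}. S' t = S t)) \<and>
      ((\<forall>Y. advanced_solution p \<delta> s T (Ahat p \<delta> S) Y \<longrightarrow> (\<forall>t\<in>{s..T}. pos_def (Y t))) \<longrightarrow>
        (spd M \<longrightarrow> continuous_on {s..T} S \<and> (\<forall>t\<in>{s..T}. spd (S t))) \<and>
        (psd M \<longrightarrow> continuous_on {s..T} S \<and> (\<forall>t\<in>{s..T}. psd (S t)))))"
proof -
  \<comment> \<open>Almost everywhere \<open>calN\<close> is coercive with constant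
    \<open>2 * \<alpha>\<close>, and \<open>L\<close> is the resulting bound on its inverse.\<close>
  define L where "L = CARD('d) * CARD('d) * (1 / (2 * \<alpha>))"
  define K' where "K' = \<bar>K\<bar>"
  \<comment> \<open>The term \<open>2 * K'\<close> covers \<open>q\<close>, together with the norm
    of the identity also \<open>a\<close>, and the last term covers \<open>h\<close>; the leading
    \<open>1\<close> ensures \<open>1 \<le> k\<close>.\<close>
  define k where "k = 1 + 2 * K' + norm (mat 1 :: real^'n^'n) + 2 * (K' * L * K')"
  \<comment> \<open>The full length \<open>T\<close> in place of \<open>T - s\<close> makes the
    threshold independent of \<open>s\<close>.\<close>
  define \<rho> where "\<rho> = CARD('n) * CARD('n) * (k * exp ((2 * k + 3 * k\<^sup>2 + 1) * T))"
  define \<mu> where "\<mu> = 4 * k + 8 * k * \<rho> + 6 * k\<^sup>2 + 1"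
  have L0: "0 \<le> L" using \<open>0 < \<alpha>\<close> by (simp add: L_def)
  have K': "0 \<le> K'" "K \<le> K'" by (auto simp: K'_def)
  have KLK: "0 \<le> K' * L * K'" using L0 K' by simp
  have k: "1 \<le> k" "2 * K' \<le> k" "K' + norm (mat 1 :: real^'n^'n) \<le> k" "K' * L * K' + K' * L * K' \<le> k"
    using K' KLK norm_ge_zero[of "mat 1 :: real^'n^'n"] unfolding k_def by linarith+
  have \<mu>: "0 < \<mu>"
    unfolding \<mu>_def using k by (intro add_nonneg_pos add_nonneg_nonneg) (auto simp: \<rho>_def)
  have main: "\<exists>S. (riccati_solution p \<delta> s T M S \<and> continuous_on {s..T} S \<and> (\<forall>t\<in>{s..T}. psd (S t))) \<and>
      (\<forall>S'. riccati_solution p \<delta> s T M S' \<and> continuous_on {s..T} S' \<and> (\<forall>t\<in>{s..T}. psd (S' t)) \<longrightarrow>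
        (\<forall>t\<in>{s..T}. S' t = S t)) \<and>
      (spd M \<longrightarrow> (\<forall>t\<in>{s..T}. spd (S t)))"
    if \<delta>: "0 < \<delta>" "\<delta> \<le> 1 / \<mu>" and s: "s \<in> {0..T}" and adm: "admissible K \<alpha> s T \<delta> p"
      and M: "psd M" "norm M \<le> K" and B: "\<forall>t\<in>{s..T}. cB p t = mat 1"
    for \<delta> s and p :: "('n, 'd) lq_coeffs" and M :: "real^'n^'n"
  proof -
    have sT: "s \<le> T" and s0: "0 \<le> s" using s by auto
    \<comment> \<open>The positivity assumptions hold almost everywhere only; the indicators make them hold everywhere.\<close>
    define a where "a t = cA p t + (1/2) *\<^sub>R mat 1" for t
    define Qs where "Qs t = cQ p t + cQbar p (t + \<delta>)" for t
    define q where "q t = indicator {X. psd X} (Qs t) *\<^sub>R Qs t" for t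
    define Ni where "Ni t = indicator (coercive_matrices (2 * \<alpha>)) (calN p \<delta> t) *\<^sub>R matrix_inv (calN p \<delta> t)" for t
    define h where "h t = cC p t ** Ni t ** transpose (cC p t)
      + cCbar p t ** Ni (t - \<delta>) ** transpose (cCbar p t)" for t
    have bm: "bounded_measurable K {s..T} (cA p)" "bounded_measurable K {s..T+\<delta>} (cBbar p)"
      "bounded_measurable K {s..T} (cC p)" "bounded_measurable K {s..T} (cCbar p)"
      "bounded_measurable K {s-\<delta>..T} (cQ p)" "bounded_measurable K {s..T+\<delta>} (cQbar p)"
      "bounded_measurable K {s-\<delta>..T} (cN p)" "bounded_measurable K {s..T+\<delta>} (cNbar p)"
      and AE_Q: "AE t in lebesgue. t \<in> {s-\<delta>..T} \<longrightarrow> psd (cQ p t + cQbar p (t+\<delta>))"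
      and AE_N: "AE t in lebesgue. t \<in> {s-\<delta>..T} \<longrightarrow> psd (cN p t + cNbar p (t + \<delta>) - \<alpha> *\<^sub>R mat 1)"
      and symN: "\<forall>t\<in>{s-\<delta>..T}. transpose (cN p t) = cN p t" "\<forall>t\<in>{s..T+\<delta>}. transpose (cNbar p t) = cNbar p t"
      using adm unfolding admissible_def by blast+
    have bmA: "bounded_measurable k {s..T} a"
    proof -
      have "bounded_measurable (K + norm (mat 1 :: real^'n^'n)) {s..T} a"
        unfolding a_def using bm(1) by (intro bounded_measurable_add bounded_measurable_const) auto
      then show ?thesis by (rule bounded_measurable_mono) (use k K' in auto)
    qed
    have bmB: "bounded_measurable k {s..T} (cBbar p)"
      using bm(2) by (rule bounded_measurable_mono) (use k K' \<delta> in auto)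
    have bmQs: "bounded_measurable (K + K) {s..T} Qs"
      unfolding Qs_def
      by (intro bounded_measurable_add bounded_measurable_mono[OF bm(5)] bounded_measurable_shift[OF bm(6)])
        (use \<delta> in auto)
    have bmq: "bounded_measurable k {s..T} q"
      unfolding q_def
    proof (rule bounded_measurable_indicator_compose[where g="\<lambda>x. x"])
      show "Qs \<in> borel_measurable (lebesgue_on {s..T})" using bmQs by (simp add: bounded_measurable_def)
      show "norm (Qs t) \<le> k" if "t \<in> {s..T}" for t
      proof -
        have "norm (Qs t) \<le> K + K" using bmQs that by (auto simp: bounded_measurable_def)
        then show ?thesis using k K' by linarith
      qed
    qed (use k in \<open>auto intro: closed_psd continuous_on_id\<close>)
    have bmN: "calN p \<delta> \<in> borel_measurable (lebesgue_on {s-\<delta>..T})"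
    proof -
      have "bounded_measurable (\<bar>2\<bar> * K + \<bar>2\<bar> * K) {s-\<delta>..T} (\<lambda>t. 2 *\<^sub>R cN p t + 2 *\<^sub>R cNbar p (t + \<delta>))"
        by (intro bounded_measurable_add bounded_measurable_scaleR bm(7)
            bounded_measurable_shift[OF bm(8)]) auto
      then show ?thesis unfolding calN_def[abs_def] bounded_measurable_def by blast
    qed
    have bmNi: "bounded_measurable L {s-\<delta>..T} Ni"
      unfolding Ni_def
      using norm_coercive_inverse[of "2 * \<alpha>", where 'n='d] \<open>0 < \<alpha>\<close> L0
      by (intro bounded_measurable_indicator_compose[OF bmN] closed_coercive_matrices
          continuous_on_coercive_inverse) (auto simp: L_def)
    have bmh: "bounded_measurable k {s..T} h"
    proof -
      have "bounded_measurable (K' * L * K' + K' * L * K') {s..T} h"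
        unfolding h_def
      proof (intro bounded_measurable_add bounded_measurable_congruence K' L0)
        show "bounded_measurable K' {s..T} (cC p)" "bounded_measurable K' {s..T} (cCbar p)"
          using bm(3,4) K' by (auto intro: bounded_measurable_mono)
        show "bounded_measurable L {s..T} Ni"
          using bmNi \<delta> by (auto intro: bounded_measurable_mono)
        show "bounded_measurable L {s..T} (\<lambda>t. Ni (t - \<delta>))"
          using bounded_measurable_shift[OF bmNi, of s "- \<delta>" T] \<delta> by simp
      qed
      then show ?thesis by (rule bounded_measurable_mono) (use k in auto)
    qed
    have q_psd: "psd (q t)" for t
      by (cases "psd (Qs t)") (simp_all add: q_def psd_zero)
    have Ni_psd: "psd (Ni t)" if t: "t \<in> {s-\<delta>..T}" for t
    proof (cases "calN p \<delta> t \<in> coercive_matrices (2 * \<alpha>)")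
      case True
      have "transpose (calN p \<delta> t) = calN p \<delta> t"
        using symN t by (simp add: calN_def transpose_add transpose_scalar)
      then show ?thesis
        using True \<open>0 < \<alpha>\<close> psd_coercive_inverse[of "2 * \<alpha>" "calN p \<delta> t"] by (simp add: Ni_def)
    qed (simp add: Ni_def psd_zero)
    have h_psd: "psd (h t)" if "t \<in> {s..T}" for t
      unfolding h_def using that \<delta> by (intro psd_add psd_congruence Ni_psd) auto
    have \<rho>: "CARD('n) * CARD('n) * (k * exp ((2 * k + 3 * k\<^sup>2 + 1) * (T - s))) \<le> \<rho>"
      unfolding \<rho>_def using s0 k by (intro mult_left_mono) (auto intro!: mult_left_mono)
    have small: "(4 * k + 8 * k * \<rho> + 6 * k\<^sup>2 + 1) * \<delta> \<le> 1"
      unfolding \<mu>_def[symmetric] using \<delta>(2) \<mu> by (simp add: pos_le_divide_eq mult.commute)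
    interpret R: delayed_riccati s T \<delta> k \<rho> a "cBbar p" q h M
      by unfold_locales
        (use sT \<delta> k K' bmA bmB bmq bmh q_psd h_psd M \<rho> small in \<open>auto intro: order_trans[of _ K]\<close>)
    obtain N1 where N1: "negligible N1"
      "\<And>t. t \<notin> N1 \<Longrightarrow> t \<in> {s-\<delta>..T} \<longrightarrow> psd (cQ p t + cQbar p (t + \<delta>))"
      using AE_lebesgue_negligible[OF AE_Q] by blast
    obtain N2 where N2: "negligible N2"
      "\<And>t. t \<notin> N2 \<Longrightarrow> t \<in> {s-\<delta>..T} \<longrightarrow> psd (cN p t + cNbar p (t + \<delta>) - \<alpha> *\<^sub>R mat 1)"
      using AE_lebesgue_negligible[OF AE_N] by blast
    \<comment> \<open>The equation also evaluates \<open>calN\<close> at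
      \<open>t - \<delta>\<close>, so a translated null set has to be excluded.\<close>
    obtain N3 where N3: "negligible N3"
      "\<And>t. t \<notin> N3 \<Longrightarrow> t + - \<delta> \<in> {s-\<delta>..T} \<longrightarrow> psd (cN p (t + - \<delta>) + cNbar p (t + - \<delta> + \<delta>) - \<alpha> *\<^sub>R mat 1)"
      using AE_lebesgue_shift_negligible[OF AE_N, of "- \<delta>"] by blast
    define N where "N = N1 \<union> N2 \<union> N3"
    have negl: "negligible N" using N1 N2 N3 by (simp add: N_def)
    have coercive: "calN p \<delta> t \<in> coercive_matrices (2 * \<alpha>)"
      if "psd (cN p t + cNbar p (t + \<delta>) - \<alpha> *\<^sub>R mat 1)" for t
      unfolding coercive_matrices_def
    proof (intro CollectI allI)
      fix x
      have "0 \<le> x \<bullet> ((cN p t + cNbar p (t + \<delta>) - \<alpha> *\<^sub>R mat 1) *v x)"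
        using that by (simp add: psd_def)
      then show "2 * \<alpha> * (x \<bullet> x) \<le> x \<bullet> (calN p \<delta> t *v x)"
        by (simp add: calN_def quadratic_form_simps)
    qed
    \<comment> \<open>Off \<open>N\<close> the indicators equal one, and the prescribed history
      makes \<open>R.ext\<close> agree with \<open>X\<close> at the delayed time. Half of the
      identity on each side of \<open>X t\<close> reproduces the term with
      \<open>cB p t = mat 1\<close>.\<close>
    have rhs_eq: "- riccati_rhs p \<delta> X t = R.rhs X t"
      if t: "t \<in> {s..T}" "t \<notin> N" and init: "\<forall>t\<in>{s-\<delta>..<s}. X t = mat 1" for X t
    proof -
      have "psd (Qs t)" using N1(2)[of t] t \<delta> by (simp add: N_def Qs_def)
      then have q: "q t = cQ p t + cQbar p (t + \<delta>)" by (simp add: q_def Qs_def)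
      have "calN p \<delta> t \<in> coercive_matrices (2 * \<alpha>)" "calN p \<delta> (t - \<delta>) \<in> coercive_matrices (2 * \<alpha>)"
        using N2(2)[of t] N3(2)[of t] t \<delta> by (auto simp: N_def intro!: coercive)
      then have Ni: "Ni t = matrix_inv (calN p \<delta> t)" "Ni (t - \<delta>) = matrix_inv (calN p \<delta> (t - \<delta>))"
        by (simp_all add: Ni_def)
      have ext: "R.ext X (t - \<delta>) = X (t - \<delta>)"
        using init t by (auto simp: R.ext_def)
      have "X t ** transpose (a t) + a t ** X t = X t ** transpose (cA p t) + cA p t ** X t + X t"
        by (simp add: a_def transpose_add transpose_scalar matrix_add_ldistrib matrix_add_rdistrib
            matrix_scaleR_mult)
      then show ?thesis
        using B t by (simp add: riccati_rhs_def R.rhs_def q h_def Ni ext)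
    qed
    have sol_iff: "riccati_solution p \<delta> s T M X \<longleftrightarrow> R.rhs X absolutely_integrable_on {s..T} \<and>
        (\<forall>t\<in>{s..T}. X t = M + integral {t..T} (R.rhs X))"
      if init: "\<forall>t\<in>{s-\<delta>..<s}. X t = mat 1" for X
    proof -
      have "riccati_rhs p \<delta> X absolutely_integrable_on {s..T}
          \<longleftrightarrow> (\<lambda>t. - riccati_rhs p \<delta> X t) absolutely_integrable_on {s..T}"
        by (simp add: absolutely_integrable_on_def integrable_neg_iff)
      also have "\<dots> \<longleftrightarrow> R.rhs X absolutely_integrable_on {s..T}"
        by (rule absolutely_integrable_spike_eq[OF negl]) (use rhs_eq init in auto)
      finally have abs: "riccati_rhs p \<delta> X absolutely_integrable_on {s..T}
          \<longleftrightarrow> R.rhs X absolutely_integrable_on {s..T}" .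
      have int: "integral {t..T} (\<lambda>t. - riccati_rhs p \<delta> X t) = integral {t..T} (R.rhs X)" if "t \<in> {s..T}" for t
        by (rule integral_spike[OF negl]) (use rhs_eq init that in auto)
      have iff: "(\<forall>t\<in>{s..T}. X t = X T + integral {t..T} (\<lambda>t. - riccati_rhs p \<delta> X t))
          \<longleftrightarrow> (\<forall>t\<in>{s..T}. X t = X T + integral {t..T} (R.rhs X))"
        by (intro ball_cong refl) (simp only: int)
      \<comment> \<open>At \<open>t = T\<close> the integral vanishes, so the integral equation
        already contains the terminal condition.\<close>
      have XT: "X T = M" if "\<forall>t\<in>{s..T}. X t = M + integral {t..T} (R.rhs X)"
        using bspec[OF that, of T] sT by simp
      show ?thesis
        unfolding riccati_solution_def ode_solution_terminal_iff[OF sT] abs iff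
      proof (cases "X T = M")
        case False
        then show "(R.rhs X absolutely_integrable_on {s..T} \<and>
            (\<forall>t\<in>{s..T}. X t = X T + integral {t..T} (R.rhs X))) \<and> X T = M \<and> (\<forall>t\<in>{s-\<delta>..<s}. X t = mat 1)
          \<longleftrightarrow> R.rhs X absolutely_integrable_on {s..T} \<and> (\<forall>t\<in>{s..T}. X t = M + integral {t..T} (R.rhs X))"
          using XT by blast
      qed (use init in simp)
    qed
    obtain Y where Y: "continuous_on {s..T} Y" "\<And>t. t \<in> {s..T} \<Longrightarrow> psd (Y t)"
      "R.rhs Y absolutely_integrable_on {s..T}" "\<And>t. t \<in> {s..T} \<Longrightarrow> Y t = M + integral {t..T} (R.rhs Y)"
      using R.riccati_exists by blast
    \<comment> \<open>The locale determines \<open>Y\<close> on \<open>{s..T}\<close> only;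
      \<open>R.ext\<close> installs the history that \<open>riccati_solution\<close>
      demands.\<close>
    define S where "S = R.ext Y"
    have SY: "S t = Y t" if "t \<in> {s..T}" for t using that by (simp add: S_def R.ext_def)
    have init: "\<forall>t\<in>{s-\<delta>..<s}. S t = mat 1" by (simp add: S_def R.ext_def)
    have rhsS: "R.rhs S t = R.rhs Y t" if "t \<in> {s..T}" for t
      using SY[OF that] by (simp add: R.rhs_def S_def R.ext_def)
    have S: "continuous_on {s..T} S" "\<And>t. t \<in> {s..T} \<Longrightarrow> psd (S t)"
      using Y(1,2) SY by (auto intro: continuous_on_eq)
    have absS: "R.rhs S absolutely_integrable_on {s..T}"
      using Y(3) by (rule absolutely_integrable_spike[where S="{}"]) (auto simp: rhsS)
    have solS: "S t = M + integral {t..T} (R.rhs S)" if t: "t \<in> {s..T}" for t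
    proof -
      have "integral {t..T} (R.rhs S) = integral {t..T} (R.rhs Y)"
        using t by (intro integral_cong) (simp add: rhsS)
      then show ?thesis using Y(4)[OF t] SY[OF t] by simp
    qed
    have intS: "R.rhs S integrable_on {s..T}" using absS set_lebesgue_integral_eq_integral(1) by blast
    show ?thesis
    proof (intro exI[of _ S] conjI ballI allI impI)
      show "riccati_solution p \<delta> s T M S" using sol_iff[OF init] absS solS by blast
      show "continuous_on {s..T} S" by (rule S)
      show "psd (S t)" if "t \<in> {s..T}" for t using that by (rule S)
      fix t assume t: "t \<in> {s..T}"
      show "S' t = S t"
        if S': "riccati_solution p \<delta> s T M S' \<and> continuous_on {s..T} S' \<and> (\<forall>t\<in>{s..T}. psd (S' t))" for S'
      proof (rule R.riccati_unique)
        have "\<forall>t\<in>{s-\<delta>..<s}. S' t = mat 1" using S' by (simp add: riccati_solution_def)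
        then have *: "R.rhs S' absolutely_integrable_on {s..T}"
          "\<And>t. t \<in> {s..T} \<Longrightarrow> S' t = M + integral {t..T} (R.rhs S')"
          using S' sol_iff[of S'] by blast+
        show "R.rhs S' integrable_on {s..T}" using *(1) set_lebesgue_integral_eq_integral(1) by blast
        show "S' r = M + integral {r..T} (R.rhs S')" if "r \<in> {s..T}" for r using that by (rule *(2))
      qed (use S' S intS solS t in auto)
      assume spdM: "spd M"
      show "spd (S t)"
      proof (rule R.riccati_spd[OF S _ _ _ spdM t])
        show "norm (S r) \<le> \<rho>" if "r \<in> {s..T}" for r
          using S intS solS that by (rule R.riccati_solution_le_\<rho>)
        show "(R.rhs S has_integral S r - M) {r..T}" if "r \<in> {s..T}" for r
          using intS solS that by (rule R.terminal_has_integral)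
        show "S T = M" using solS[of T] sT by simp
      qed
    qed
  qed
  show ?thesis
  \<comment> \<open>The threshold \<open>1 / \<mu>\<close> is built from \<open>T\<close>,
    \<open>K\<close>, \<open>\<alpha>\<close> and the dimensions alone, hence precedes the choice of
    \<open>\<delta>\<close>, \<open>s\<close>, \<open>p\<close> and \<open>M\<close>.\<close>
  proof (intro exI[of _ "1 / \<mu>"] conjI allI impI)
    show "0 < 1 / \<mu>" using \<mu> by simp
    fix \<delta> s and p :: "('n, 'd) lq_coeffs" and M :: "real^'n^'n"
    assume "0 < \<delta>" "\<delta> \<le> 1 / \<mu>" "s \<in> {0..T}" "admissible K \<alpha> s T \<delta> p" "psd M" "norm M \<le> K"
      "\<forall>t\<in>{s..T}. cB p t = mat 1"
    from main[OF this] show "\<exists>S. (riccati_solution p \<delta> s T M S \<and> continuous_on {s..T} S \<and> (\<forall>t\<in>{s..T}. psd (S t))) \<and>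
      (\<forall>S'. riccati_solution p \<delta> s T M S' \<and> continuous_on {s..T} S' \<and> (\<forall>t\<in>{s..T}. psd (S' t)) \<longrightarrow>
        (\<forall>t\<in>{s..T}. S' t = S t)) \<and>
      ((\<forall>Y. advanced_solution p \<delta> s T (Ahat p \<delta> S) Y \<longrightarrow> (\<forall>t\<in>{s..T}. pos_def (Y t))) \<longrightarrow>
        (spd M \<longrightarrow> continuous_on {s..T} S \<and> (\<forall>t\<in>{s..T}. spd (S t))) \<and>
        (psd M \<longrightarrow> continuous_on {s..T} S \<and> (\<forall>t\<in>{s..T}. psd (S t))))"
      by blast
  qed
qed

end
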